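(* For all integers $n \ge 1$ and $1 \le k \le n$, \[ R(n,k) = \sum_{m=k+1}^{n+1} (-1)^{m+k-1}\binom{n}{m-1}\, m\,(n+1)^{n-m}\, c(m,m-k), \] where $c(\cdot,\cdot)$ denotes the unsigned Stirling numbers of the first kind.
   Context: A rooted tree is a labelled tree with a distinguished vertex (its root). A rooted forest on $[n]=\{1,\dots,n\}$ is a set of rooted trees whose vertex sets are pairwise disjoint with union $[n]$. A vertex $v$ of a rooted forest is a record if its label is the largest label on the unique path from $v$ to the root of its tree (both endpoints included); roots are always records. $R(n,k)$ denotes the number of rooted forests on $[n]$ with exactly $k$ records. $c(m,j)$ is the number of permutations of $[m]$ with exactly $j$ cycles. *)

theory Defs
  imports
    Complex_Main
    "HOL-Library.Disjoint_Sets"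
    "HOL-Combinatorics.Permutations"
    "HOL-Combinatorics.Orbits"
begin

text \<open>
  Edges are two-element vertex sets. The notion of tree from Graph_Theory is not used: it forbids
  directed cycles, and modelling undirected edges as symmetric arcs makes every edge such a cycle.
\<close>

datatype 'a rooted_graph = Rooted_Graph (verts: "'a set") (edges: "'a set set") (root_of: 'a)

definition walk :: "'a set set \<Rightarrow> 'a list \<Rightarrow> bool" where
  "walk E p \<longleftrightarrow> (\<forall>i. Suc i < length p \<longrightarrow> {p ! i, p ! Suc i} \<in> E)"

definition path_between :: "'a set \<Rightarrow> 'a set set \<Rightarrow> 'a \<Rightarrow> 'a list \<Rightarrow> 'a \<Rightarrow> bool" where
  "path_between V E u p v \<longleftrightarrow>
     p \<noteq> [] \<and> hd p = u \<and> last p = v \<and> set p \<subseteq> V \<and> distinct p \<and> walk E p"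

definition cycle :: "'a set \<Rightarrow> 'a set set \<Rightarrow> 'a list \<Rightarrow> bool" where
  "cycle V E p \<longleftrightarrow>
     3 \<le> length p \<and> set p \<subseteq> V \<and> distinct p \<and> walk E p \<and> {last p, hd p} \<in> E"

definition simple_graph :: "'a set \<Rightarrow> 'a set set \<Rightarrow> bool" where
  "simple_graph V E \<longleftrightarrow> finite V \<and> (\<forall>e\<in>E. \<exists>u\<in>V. \<exists>v\<in>V. u \<noteq> v \<and> e = {u, v})"

definition tree :: "'a set \<Rightarrow> 'a set set \<Rightarrow> bool" where
  "tree V E \<longleftrightarrow> simple_graph V E \<and> V \<noteq> {} \<and>
     (\<forall>u\<in>V. \<forall>v\<in>V. \<exists>p. path_between V E u p v) \<and> (\<nexists>p. cycle V E p)"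

definition rooted_tree :: "'a rooted_graph \<Rightarrow> bool" where
  "rooted_tree T \<longleftrightarrow> tree (verts T) (edges T) \<and> root_of T \<in> verts T"

definition rooted_forest :: "nat \<Rightarrow> nat rooted_graph set \<Rightarrow> bool" where
  "rooted_forest n F \<longleftrightarrow>
     (\<forall>T\<in>F. rooted_tree T) \<and> disjoint_family_on verts F \<and> (\<Union>T\<in>F. verts T) = {1..n}"

text \<open>The path below is unique because \<open>T\<close> is a tree.\<close>

definition is_record :: "nat rooted_graph set \<Rightarrow> nat \<Rightarrow> bool" where
  "is_record F v \<longleftrightarrow>
     (\<exists>T\<in>F. \<exists>p. path_between (verts T) (edges T) v p (root_of T) \<and> (\<forall>w\<in>set p. w \<le> v))"

definition num_record_forests :: "nat \<Rightarrow> nat \<Rightarrow> nat" where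
  "num_record_forests n k = card {F. rooted_forest n F \<and> card {v. is_record F v} = k}"

text \<open>The cycles of a permutation of \<open>{1..m}\<close>, fixed points included, correspond to its orbits.\<close>

definition num_cycle_perms :: "nat \<Rightarrow> nat \<Rightarrow> nat" where
  "num_cycle_perms m j = card {\<pi>. \<pi> permutes {1..m} \<and> card (orbit \<pi> ` {1..m}) = j}"

lemma finite_rooted_forests: "finite {F. rooted_forest n F}"
proof (rule finite_subset)
  let ?S = "(\<lambda>(V, E, r). Rooted_Graph V E r) ` (Pow {1..n} \<times> Pow (Pow {1..n}) \<times> {1..n})"
  show "finite (Pow ?S)" by simp
  show "{F. rooted_forest n F} \<subseteq> Pow ?S"
  proof clarify
    fix F T assume F: "rooted_forest n F" and T: "T \<in> F"
    then have t: "rooted_tree T" and "(\<Union>T\<in>F. verts T) = {1..n}"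
      by (simp_all add: rooted_forest_def)
    with T have V: "verts T \<subseteq> {1..n}" by blast
    from t have "simple_graph (verts T) (edges T)"
      by (simp add: rooted_tree_def tree_def)
    then have "edges T \<subseteq> Pow (verts T)" by (auto simp: simple_graph_def)
    with V have E: "edges T \<subseteq> Pow {1..n}" by blast
    from t V have r: "root_of T \<in> {1..n}"
      by (auto simp: rooted_tree_def)
    have "(verts T, edges T, root_of T) \<in> Pow {1..n} \<times> Pow (Pow {1..n}) \<times> {1..n}"
      using V E r by simp
    moreover have "T = (\<lambda>(V, E, r). Rooted_Graph V E r) (verts T, edges T, root_of T)"
      by simp
    ultimately show "T \<in> ?S" by (rule rev_image_eqI)
  qed
qed

end

theory Submission
  imports
    Defs
    "HOL-Computational_Algebra.Polynomial"
    "HOL-Combinatorics.Stirling"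
begin

text \<open>
  A rooted forest is the same as an acyclic parent map. The largest vertex \<open>n\<close> is always a record
  and none of its descendants is one, so removing \<open>n\<close> together with its set \<open>D\<close> of descendants
  gives, for the generating polynomials \<open>R\<^sub>N(x)\<close> of forests by records,
  \<open>R\<^sub>N\<^sub>+\<^sub>1 = x \<Sum>\<^sub>s (N choose s) T\<^sub>s (N - s + 1) R\<^sub>N\<^sub>-\<^sub>s\<close>, where \<open>T\<^sub>s = R\<^sub>s(1)\<close> counts the forests on
  \<open>D\<close> and \<open>N - s + 1\<close> the possible parents of \<open>n\<close>. By Abel's identity the polynomials
  \<open>\<Sum>\<^sub>i (n choose i) (i + 1) (n + 1)^(n - 1 - i) \<Prod>\<^sub>j\<^sub>\<le>\<^sub>i (j x - 1)\<close> satisfy the same recurrence,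
  and the coefficients of the products are signed Stirling numbers.
\<close>

section \<open>Abel's identity\<close>

text \<open>The recurrence for the polynomials also involves the forest counts \<open>T_s\<close>.
  Both come out of one strong induction on the number of vertices: in the candidate polynomial every
  product with \<open>i \<ge> 1\<close> contains the factor \<open>x - 1\<close>, so its value at
  \<open>x = 1\<close> collapses to \<open>(s + 1)^(s - 1)\<close>. The number of possible parents,
  \<open>N - s + 1\<close>, is what makes the recurrence tractable: it cancels the negative exponent
  in the candidate for \<open>N - s\<close>. Exchanging the two summations then leaves, for each
  \<open>i\<close>, an instance of Abel's identity with \<open>y = i + 1\<close>, and the outer
  factor \<open>x\<close> is absorbed by \<open>(i + 1) x P_i = P_i + P_(i+1)\<close>, where
  \<open>P_i\<close> is the product up to \<open>i\<close>. On the combinatorial side, cutting a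
  forest at a vertex is awkward with undirected edges and paths, but is mere restriction for parent
  maps. The price is a proof that a simple path ending at the root always follows parents, and that
  every edge of a tree joins a vertex to its parent.\<close>

lemma alternating_binomial_sum_power:
  fixes c :: real
  assumes "k < n"
  shows "(\<Sum>s\<le>n. (-1) ^ s * real (n choose s) * (real s + c) ^ k) = 0"
  using assms
proof (induction n arbitrary: k)
  case (Suc n)
  let ?q = "\<lambda>s. (real s + c) ^ k"
  \<comment> \<open>Pascal's rule turns the sum for \<open>Suc n\<close> into minus the sum for
    \<open>n\<close> of the first difference of the power. That difference only has powers
    \<open>j < k \<le> n\<close>, so the induction hypothesis kills each of them.\<close>
  have "(\<Sum>s\<le>Suc n. (-1) ^ s * real (Suc n choose s) * ?q s) =
        (\<Sum>s\<le>n. (-1) ^ s * real (n choose s) * ?q s)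
          - (\<Sum>s\<le>n. (-1) ^ s * real (n choose s) * ?q (Suc s))"
  proof -
    have "(\<Sum>s\<le>Suc n. (-1) ^ s * real (n choose s) * ?q s) =
          (\<Sum>s\<le>n. (-1) ^ s * real (n choose s) * ?q s)" by simp
    moreover have "(\<Sum>s\<le>Suc n. (-1) ^ s * real (n choose s) * ?q s) =
        ?q 0 + (\<Sum>s\<le>n. (-1) ^ Suc s * real (n choose Suc s) * ?q (Suc s))"
      by (subst sum.atMost_Suc_shift) simp
    moreover have "(\<Sum>s\<le>Suc n. (-1) ^ s * real (Suc n choose s) * ?q s) =
        ?q 0 + (\<Sum>s\<le>n. (-1) ^ Suc s * real (n choose Suc s) * ?q (Suc s))
          - (\<Sum>s\<le>n. (-1) ^ s * real (n choose s) * ?q (Suc s))"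
      by (subst sum.atMost_Suc_shift) (simp add: algebra_simps sum.distrib sum_negf sum_subtractf)
    ultimately show ?thesis by linarith
  qed
  also have "\<dots> = - (\<Sum>s\<le>n. (-1) ^ s * real (n choose s) * (?q (Suc s) - ?q s))"
    by (simp add: right_diff_distrib sum_subtractf)
  also have "\<dots> = - (\<Sum>s\<le>n. \<Sum>j<k. real (k choose j) *
      ((-1) ^ s * real (n choose s) * (real s + c) ^ j))"
  proof -
    have "?q (Suc s) - ?q s = (\<Sum>j<k. real (k choose j) * (real s + c) ^ j)" for s
    proof -
      have "?q (Suc s) = ((real s + c) + 1) ^ k" by (simp add: algebra_simps)
      also have "\<dots> = (\<Sum>j\<le>k. real (k choose j) * (real s + c) ^ j)"
        by (simp add: binomial_ring)
      finally show ?thesis by (simp flip: lessThan_Suc_atMost)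
    qed
    thus ?thesis by (simp add: sum_distrib_left mult_ac)
  qed
  also have "\<dots> = - (\<Sum>j<k. real (k choose j) *
      (\<Sum>s\<le>n. (-1) ^ s * real (n choose s) * (real s + c) ^ j))"
    by (subst sum.swap) (simp add: sum_distrib_left)
  also have "\<dots> = 0" using Suc by simp
  finally show ?case .
qed simp

lemma binomial_absorb_diff: "(n choose s) * (n - s) = n * ((n - 1) choose s)"
  by (metis binomial_absorb_comp mult.commute)

text \<open>
  Both sides have the same derivative in \<open>y\<close> by induction, and at \<open>y = - n - 1\<close> the left-hand side is an
  \<open>n\<close>-th difference of a polynomial of degree \<open>n - 1\<close>. At \<open>s = 0\<close> the truncated exponent is harmless
  because the base is \<open>1\<close>.
\<close>

lemma abel_identity:
  fixes y :: real
  shows "(\<Sum>s\<le>n. real (n choose s) * (real s + 1) ^ (s - 1) * (y + real (n - s)) ^ (n - s))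
    = (y + real n + 1) ^ n"
proof (induction n arbitrary: y)
  case (Suc n)
  define L where "L = (\<lambda>y. \<Sum>s\<le>Suc n. real (Suc n choose s) * (real s + 1) ^ (s - 1)
    * (y + real (Suc n - s)) ^ (Suc n - s))"
  define D where "D = (\<lambda>y. L y - (y + real (Suc n) + 1) ^ Suc n)"
  have "(D has_real_derivative 0) (at y)" for y
  proof -
    have "(D has_real_derivative (\<Sum>s\<le>Suc n. real (Suc n choose s) * (real s + 1) ^ (s - 1)
        * (real (Suc n - s) * (y + real (Suc n - s)) ^ (Suc n - s - 1)))
        - real (Suc n) * (y + real (Suc n) + 1) ^ n) (at y)"
      unfolding D_def L_def
      by (intro DERIV_diff DERIV_sum)
        (auto intro!: derivative_eq_intros, cases n, auto simp: algebra_simps)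
    \<comment> \<open>The summand \<open>s = Suc n\<close> is constant in \<open>y\<close>. In the
      others absorption extracts the factor \<open>Suc n\<close> and leaves the identity for
      \<open>n\<close> at \<open>y + 1\<close>.\<close>
    moreover have "(\<Sum>s\<le>Suc n. real (Suc n choose s) * (real s + 1) ^ (s - 1)
        * (real (Suc n - s) * (y + real (Suc n - s)) ^ (Suc n - s - 1)))
      = (\<Sum>s\<le>n. real (Suc n) * (real (n choose s) * (real s + 1) ^ (s - 1)
          * ((y + 1) + real (n - s)) ^ (n - s)))"
    proof -
      have "real (Suc n choose s) * (real s + 1) ^ (s - 1)
          * (real (Suc n - s) * (y + real (Suc n - s)) ^ (Suc n - s - 1))
        = real (Suc n) * (real (n choose s) * (real s + 1) ^ (s - 1)
          * ((y + 1) + real (n - s)) ^ (n - s))" if "s \<le> n" for s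
      proof -
        have absorb: "real (Suc n choose s) * real (Suc n - s) = real (Suc n) * real (n choose s)"
          using binomial_absorb_diff[of "Suc n" s] by (metis diff_Suc_1 of_nat_mult)
        have eqs: "y + real (Suc n - s) = (y + 1) + real (n - s)" "Suc n - s - 1 = n - s"
          using that by auto
        have "a * v * (c * w) = r * (b * v * w)" if "a * c = r * b" for a b c r v w :: real
          using that by algebra
        from this[OF absorb] show ?thesis unfolding eqs .
      qed
      note summand = this
      show ?thesis
        unfolding sum.atMost_Suc diff_self_eq_0 of_nat_0 mult_zero_left mult_zero_right add_0_right
        by (intro sum.cong refl summand) simp
    qed
    ultimately show ?thesis
      using Suc[of "y + 1"] by (simp add: sum_distrib_left[symmetric] add_ac)
  qed
  hence "D y = D (- (real (Suc n) + 1))"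
    using DERIV_isconst_all by blast
  also have "D (- (real (Suc n) + 1)) = L (- (real (Suc n) + 1))" by (simp add: D_def)
  also have "\<dots> = (-1) ^ Suc n * (\<Sum>s\<le>Suc n. (-1) ^ s * real (Suc n choose s) * (real s + 1) ^ n)"
    unfolding L_def sum_distrib_left
  proof (intro sum.cong refl)
    fix s assume "s \<in> {..Suc n}"
    hence s: "s \<le> Suc n" by simp
    have "- (real (Suc n) + 1) + real (Suc n - s) = - 1 * (real s + 1)" using s by simp
    hence base: "(- (real (Suc n) + 1) + real (Suc n - s)) ^ (Suc n - s)
      = (-1) ^ (Suc n - s) * (real s + 1) ^ (Suc n - s)" by (simp only: power_mult_distrib)
    have sign: "(-1::real) ^ (Suc n - s) = (-1) ^ Suc n * (-1) ^ s"
      using s by (metis minus_one_power_iff even_diff_nat even_add power_add not_less)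
    have power: "(real s + 1) ^ (s - 1) * (real s + 1) ^ (Suc n - s) = (real s + 1) ^ n"
    proof (cases s)
      case (Suc s')
      thus ?thesis using s by (simp flip: power_add)
    qed simp
    have "a * u * (b * c * v) = b * (c * a * w)" if "u * v = w" for a b c u v w :: real
      by (simp flip: that)
    from this[OF power] show "real (Suc n choose s) * (real s + 1) ^ (s - 1) *
        (- (real (Suc n) + 1) + real (Suc n - s)) ^ (Suc n - s)
      = (-1) ^ Suc n * ((-1) ^ s * real (Suc n choose s) * (real s + 1) ^ n)"
      by (simp only: base sign)
  qed
  also have "\<dots> = 0" by (simp only: alternating_binomial_sum_power[of n "Suc n" 1] lessI mult_zero_right)
  finally show ?case by (simp add: D_def L_def)
qed simp

section \<open>The record polynomials\<close>

text \<open>With \<open>t = 1/x\<close> this is \<open>x^i\<close> times the product of the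
  \<open>j - t\<close>, that is, a rising factorial with its variable negated and its coefficients
  reversed. The reversal is why the second Stirling index becomes a difference.\<close>

definition rising_prod :: "nat \<Rightarrow> real poly" where
  "rising_prod i = (\<Prod>j=1..i. [:-1, real j:])"

lemma rising_prod_0 [simp]: "rising_prod 0 = 1"
  and rising_prod_Suc: "rising_prod (Suc i) = rising_prod i * [:-1, real (Suc i):]"
  by (simp_all add: rising_prod_def)

text \<open>Up to sign, multiplication by \<open>(i + 1) x - 1\<close> is the Stirling recurrence
  read from the top index downwards. For \<open>k > i\<close> the truncated index is
  \<open>0\<close> and \<open>stirling (Suc i) 0 = 0\<close>, in agreement with the degree.\<close>

lemma coeff_rising_prod:
  "coeff (rising_prod i) k = (-1) ^ (i + k) * real (stirling (Suc i) (Suc i - k))"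
proof (induction i arbitrary: k)
  case 0
  then show ?case by (cases k) auto
next
  case (Suc i)
  show ?case
  proof (cases k)
    case 0
    then show ?thesis using Suc[of 0] by (simp add: rising_prod_Suc)
  next
    case (Suc k')
    have "coeff (rising_prod (Suc i)) k =
      real (Suc i) * coeff (rising_prod i) k' - coeff (rising_prod i) k"
      by (simp add: rising_prod_Suc mult.commute[of "rising_prod i"] Suc)
    also have "\<dots> = (-1) ^ (Suc i + k) *
      (real (Suc i) * real (stirling (Suc i) (Suc i - k')) + real (stirling (Suc i) (Suc i - k)))"
      by (simp add: Suc.IH Suc algebra_simps)
    also have "real (Suc i) * real (stirling (Suc i) (Suc i - k')) + real (stirling (Suc i) (Suc i - k))
      = real (stirling (Suc (Suc i)) (Suc (Suc i) - k))"
    proof (cases "k' \<le> i")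
      case True
      then obtain d where "i = k' + d" using le_Suc_ex by blast
      then show ?thesis using Suc by (simp add: Suc_diff_le algebra_simps)
    qed (use Suc in simp)
    finally show ?thesis .
  qed
qed

text \<open>The index \<open>i\<close> is \<open>m - 1\<close> in the theorem. At
  \<open>i = n\<close> the exponent is \<open>-1\<close>, hence the integer power; there the factor
  \<open>real i + 1\<close> cancels it.\<close>

definition record_poly :: "nat \<Rightarrow> real poly" where
  "record_poly n = (\<Sum>i\<le>n. smult (real (n choose i) * (real i + 1)
     * (real n + 1) powi (int n - 1 - int i)) (rising_prod i))"

lemma record_poly_0 [simp]: "record_poly 0 = 1"
  by (simp add: record_poly_def)

lemma smult_sum_right: "smult c (\<Sum>i\<in>S. f i) = (\<Sum>i\<in>S. smult c (f i))"
  by (induction S rule: infinite_finite_induct) (auto simp: smult_add_right)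

lemma sum_swap_triangle:
  "(\<Sum>s\<le>N. \<Sum>i\<le>N - s. f s i) = (\<Sum>i\<le>N. \<Sum>s\<le>N - i. f s i :: 'a :: comm_monoid_add)" for N :: nat
  by (simp add: sum.Sigma) (rule sum.reindex_bij_witness[of _ prod.swap prod.swap]; auto)

text \<open>The factor \<open>n + 1\<close> clears the only negative exponent. In the recurrence it
  is supplied, with \<open>N - s\<close> in place of \<open>n\<close>, by the number of possible
  parents of the largest vertex.\<close>

lemma smult_record_poly:
  "smult (real n + 1) (record_poly n) = (\<Sum>i\<le>n. smult (real (n choose i) * (real i + 1)
     * (real n + 1) ^ (n - i)) (rising_prod i))"
proof -
  have "(real n + 1) * (real n + 1) powi (int n - 1 - int i) = (real n + 1) ^ (n - i)"
    if "i \<le> n" for i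
  proof -
    have "(real n + 1) * (real n + 1) powi (int n - 1 - int i) = (real n + 1) powi (int n - int i)"
      by (subst power_int_add_1'[symmetric]) (auto simp: algebra_simps)
    also have "int n - int i = int (n - i)" using that by simp
    finally show ?thesis by simp
  qed
  thus ?thesis
    unfolding record_poly_def smult_sum_right smult_smult
    by (intro sum.cong refl arg_cong2[where f = smult])
       (simp only: mult.left_commute[of "real n + 1"] atMost_iff)
qed

text \<open>Every product with \<open>i \<ge> 1\<close> has the factor \<open>x - 1\<close>, so only
  \<open>i = 0\<close> contributes. The value is Cayley's count of rooted forests on
  \<open>n\<close> labelled vertices. At \<open>n = 0\<close> the exponents \<open>-1\<close> and
  \<open>0\<close> differ, but the base is \<open>1\<close>.\<close>

lemma poly_record_poly_1: "poly (record_poly n) 1 = (real n + 1) ^ (n - 1)"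
proof -
  have *: "poly (rising_prod i) 1 = (if i = 0 then 1 else 0)" for i
    by (induction i) (auto simp: rising_prod_Suc)
  have "poly (record_poly n) 1 = (real n + 1) powi (int n - 1)"
    by (simp add: record_poly_def poly_sum * if_distrib cong: if_cong)
  also have "\<dots> = (real n + 1) ^ (n - 1)"
    by (cases n) auto
  finally show ?thesis .
qed

lemma record_poly_Suc:
  "record_poly (Suc N) = [:0, 1:] * (\<Sum>s\<le>N. smult (real (N choose s) * (real s + 1) ^ (s - 1)
     * (real (N - s) + 1)) (record_poly (N - s)))" (is "_ = _ * ?S")
proof -
  let ?a = rising_prod
  have "?S = (\<Sum>s\<le>N. smult (real (N choose s) * (real s + 1) ^ (s - 1))
      (smult (real (N - s) + 1) (record_poly (N - s))))" by simp
  also have "\<dots> = (\<Sum>s\<le>N. \<Sum>i\<le>N - s. smult (real (N choose s) * (real s + 1) ^ (s - 1) *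
      (real ((N - s) choose i) * (real i + 1) * (real (N - s) + 1) ^ (N - s - i))) (?a i))"
    by (simp only: smult_record_poly smult_sum_right smult_smult)
  also have "\<dots> = (\<Sum>i\<le>N. \<Sum>s\<le>N - i. smult (real (N choose s) * (real s + 1) ^ (s - 1) *
      (real ((N - s) choose i) * (real i + 1) * (real (N - s) + 1) ^ (N - s - i))) (?a i))"
    by (rule sum_swap_triangle)
  also have "\<dots> = (\<Sum>i\<le>N. smult (real (N choose i) * (real i + 1) * (real N + 2) ^ (N - i)) (?a i))"
  proof (intro sum.cong refl)
    fix i assume "i \<in> {..N}"
    hence i: "i \<le> N" by simp
    \<comment> \<open>Choosing \<open>i\<close> before \<open>s\<close> moves everything free of
      \<open>s\<close> out of the sum. The base \<open>N - s + 1\<close> splits as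
      \<open>(i + 1) + (N - i - s)\<close>, which gives Abel's summand for \<open>N - i\<close> at
      \<open>y = i + 1\<close>.\<close>
    have "real (N choose s) * (real s + 1) ^ (s - 1) *
        (real ((N - s) choose i) * (real i + 1) * (real (N - s) + 1) ^ (N - s - i))
      = real (N choose i) * (real i + 1) * (real ((N - i) choose s) * (real s + 1) ^ (s - 1)
          * ((real i + 1) + real (N - i - s)) ^ (N - i - s))" if "s \<le> N - i" for s
    proof -
      have "(N choose (N - s)) * ((N - s) choose i) = (N choose i) * ((N - i) choose (N - s - i))"
        using that i by (intro choose_mult) auto
      also have "N - s - i = N - i - s" by simp
      also have "(N - i) choose (N - i - s) = (N - i) choose s"
        using that binomial_symmetric[of s "N - i"] by simp
      also have "N choose (N - s) = N choose s"
        using that by (simp flip: binomial_symmetric)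
      finally have binom: "real (N choose s) * real ((N - s) choose i)
          = real (N choose i) * real ((N - i) choose s)"
        by (metis of_nat_mult)
      have eqs: "real (N - s) + 1 = (real i + 1) + real (N - i - s)" "N - s - i = N - i - s"
        using that i by auto
      have "a * u * (b * v * w) = c * v * (d * u * w)" if "a * b = c * d"
        for a b c d u v w :: real
        using that by algebra
      from this[OF binom] show ?thesis unfolding eqs .
    qed
    note summand = this
    have "(\<Sum>s\<le>N - i. real (N choose s) * (real s + 1) ^ (s - 1) *
        (real ((N - s) choose i) * (real i + 1) * (real (N - s) + 1) ^ (N - s - i)))
      = (\<Sum>s\<le>N - i. real (N choose i) * (real i + 1) * (real ((N - i) choose s)
          * (real s + 1) ^ (s - 1) * ((real i + 1) + real (N - i - s)) ^ (N - i - s)))"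
      by (intro sum.cong refl summand) simp
    also have "\<dots> = real (N choose i) * (real i + 1) * (real i + 1 + real (N - i) + 1) ^ (N - i)"
      by (simp only: sum_distrib_left[symmetric] abel_identity)
    also have "real i + 1 + real (N - i) + 1 = real N + 2" using i by simp
    finally show "(\<Sum>s\<le>N - i. smult (real (N choose s) * (real s + 1) ^ (s - 1) *
        (real ((N - s) choose i) * (real i + 1) * (real (N - s) + 1) ^ (N - s - i))) (?a i))
      = smult (real (N choose i) * (real i + 1) * (real N + 2) ^ (N - i)) (?a i)"
      by (simp only: smult_sum[symmetric])
  qed
  finally have "[:0, 1:] * ?S = [:0, 1:] * \<dots>" by (rule arg_cong)
  also have "\<dots> = (\<Sum>i\<le>N. smult (real (N choose i) * (real N + 2) ^ (N - i)) (?a i + ?a (Suc i)))"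
    unfolding sum_distrib_left
  proof (intro sum.cong refl)
    fix i
    \<comment> \<open>Since \<open>((i + 1) x - 1) + 1 = (i + 1) x\<close>, the factor
      \<open>i + 1\<close> carried along from \<open>record_poly\<close> absorbs the multiplication
      by \<open>x\<close>.\<close>
    have "?a i + ?a (Suc i) = ?a i * ([:-1, real (Suc i):] + 1)"
      by (simp only: rising_prod_Suc distrib_left mult_1_right add.commute)
    also have "\<dots> = smult (real i + 1) ([:0, 1:] * ?a i)" by (simp add: one_pCons add.commute)
    finally show "[:0, 1:] * smult (real (N choose i) * (real i + 1) * (real N + 2) ^ (N - i)) (?a i)
      = smult (real (N choose i) * (real N + 2) ^ (N - i)) (?a i + ?a (Suc i))"
      by (simp add: mult_ac)
  qed
  \<comment> \<open>The added term \<open>i = Suc N\<close> has a zero binomial coefficient; it lets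
    the index shift align both sums on \<open>?a (Suc i)\<close>.\<close>
  also have "\<dots> = (\<Sum>i\<le>Suc N. smult (real (N choose i) * (real N + 2) ^ (N - i)) (?a i)) +
      (\<Sum>i\<le>N. smult (real (N choose i) * (real N + 2) ^ (N - i)) (?a (Suc i)))"
    by (simp add: smult_add_right sum.distrib binomial_eq_0)
  also have "\<dots> = smult ((real N + 2) ^ N) 1 + (\<Sum>i\<le>N. smult (real (N choose Suc i) *
      (real N + 2) ^ (N - Suc i) + real (N choose i) * (real N + 2) ^ (N - i)) (?a (Suc i)))"
    by (subst sum.atMost_Suc_shift) (simp add: smult_add_left sum.distrib)
  also have "\<dots> = smult ((real N + 2) ^ N) 1 + (\<Sum>i\<le>N. smult (real (Suc N choose Suc i) *
      (real (Suc i) + 1) * (real (Suc N) + 1) powi (int (Suc N) - 1 - int (Suc i))) (?a (Suc i)))"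
  proof -
    have "real (N choose Suc i) * (real N + 2) ^ (N - Suc i) + real (N choose i) * (real N + 2) ^ (N - i)
      = real (Suc N choose Suc i) * (real (Suc i) + 1) *
        (real (Suc N) + 1) powi (int (Suc N) - 1 - int (Suc i))" if "i \<le> N" for i
    \<comment> \<open>At \<open>i = N\<close> the exponent on the right is \<open>-1\<close>.
      Otherwise a common power splits off, and what remains follows from Pascal's rule and the
      absorption \<open>(i + 1) C(N + 1, i + 1) = (N + 1) C(N, i)\<close>.\<close>
    proof (cases "i = N")
      case False
      hence "i < N" using that by simp
      then obtain d where d: "N = Suc (i + d)" using less_imp_Suc_add by blast
      have "real (Suc i) * real (Suc N choose Suc i) = real (Suc N) * real (N choose i)"
        by (metis Suc_times_binomial_eq mult.commute of_nat_mult)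
      hence "real (N choose Suc i) + real (N choose i) * (real N + 2)
          = real (Suc N choose Suc i) * (real (Suc i) + 1)"
        by (simp add: algebra_simps)
      note coeff = this
      have eqs: "N - i = Suc (N - Suc i)" "int (Suc N) - 1 - int (Suc i) = int (N - Suc i)"
        using d by auto
      have Suc_N: "real (Suc N) + 1 = real N + 2" by simp
      have "c * p + c' * (u * p) = q * p" if "c + c' * u = q" for c c' q u p :: real
        by (simp add: algebra_simps flip: that)
      from this[OF coeff] show ?thesis unfolding eqs Suc_N power_Suc power_int_of_nat .
    qed (simp add: field_simps)
    thus ?thesis by simp
  qed
  also have "\<dots> = record_poly (Suc N)"
    unfolding record_poly_def by (subst sum.atMost_Suc_shift) (simp add: add_ac)
  finally show ?thesis ..
qed

section \<open>Counting permutations by orbits\<close>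

lemma permutes_orbit_eq_iff:
  assumes "p permutes S" "finite S" "x \<in> S"
  shows "orbit p x = orbit p y \<longleftrightarrow> x \<in> orbit p y"
proof -
  have "permutation p" using assms by (auto simp: permutation_permutes)
  thus ?thesis
    by (metis cyclic_on_orbit' orbit_cyclic_eq3 permutation_self_in_orbit)
qed

text \<open>The composition inserts \<open>a\<close> immediately before \<open>b\<close> in the
  cycle of \<open>b\<close>, so cutting the new cycles down to \<open>S\<close> removes nothing but
  \<open>a\<close>.\<close>

lemma orbit_transpose_insert:
  assumes p: "p permutes S" and "a \<notin> S" "b \<in> S" "x \<in> S"
  shows "orbit (transpose a b \<circ> p) x \<inter> S = orbit p x"
proof -
  let ?q = "transpose a b \<circ> p"
  have "p a = a" using assms by (simp add: permutes_def)
  hence qa: "?q a = b" by simp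
  have pS: "p y \<in> S" if "y \<in> S" for y using p that by (simp add: permutes_in_image)
  have q: "?q y = (if p y = b then a else p y)" if "y \<in> S" for y
    using pS[OF that] assms by (auto simp: transpose_def)
  have sub: "orbit p x \<subseteq> S" using p \<open>x \<in> S\<close> by (rule permutes_orbit_subset)
  have "y \<in> orbit ?q x" if "y \<in> orbit p x" for y
    using that
  proof induction
    case base
    show ?case
      using q[OF \<open>x \<in> S\<close>] qa orbit.base[of ?q x] orbit.step[of _ ?q x] by metis
  next
    case (step y)
    hence "y \<in> S" using sub by auto
    thus ?case using q[OF \<open>y \<in> S\<close>] qa step.IH orbit.step[of _ ?q x] by metis
  qed
  \<comment> \<open>An orbit of \<open>?q\<close> may pass through \<open>a\<close>, which no orbit
    of \<open>p\<close> inside \<open>S\<close> contains. Replacing \<open>a\<close> by its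
    successor \<open>b\<close> gives an invariant that survives the detour.\<close>
  moreover have "(if y = a then b else y) \<in> orbit p x" if "y \<in> orbit ?q x" for y
    using that
  proof induction
    case base
    show ?case
      using q[OF \<open>x \<in> S\<close>] orbit.base[of p x] pS[OF \<open>x \<in> S\<close>] \<open>a \<notin> S\<close> by (auto split: if_splits)
  next
    case (step y)
    show ?case
    proof (cases "y = a")
      case True
      thus ?thesis using step qa \<open>a \<notin> S\<close> \<open>b \<in> S\<close> by (auto split: if_splits)
    next
      case False
      hence y: "y \<in> orbit p x" using step by simp
      hence "y \<in> S" using sub by auto
      thus ?thesis
        using q[OF \<open>y \<in> S\<close>] orbit.step[OF y] pS[OF \<open>y \<in> S\<close>] \<open>a \<notin> S\<close> by (auto split: if_splits)
    qed
  qed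
  hence "y \<in> orbit p x" if "y \<in> orbit ?q x" "y \<noteq> a" for y using that by metis
  ultimately show ?thesis using sub \<open>a \<notin> S\<close> by blast
qed

text \<open>The new point shares the orbit of \<open>b\<close>, and intersecting with
  \<open>S\<close> matches the orbits of the new permutation bijectively with those of
  \<open>p\<close>.\<close>

lemma card_orbits_transpose_insert:
  assumes p: "p permutes S" and S: "finite S" "a \<notin> S" and b: "b \<in> S"
  shows "card (orbit (transpose a b \<circ> p) ` insert a S) = card (orbit p ` S)"
proof -
  let ?q = "transpose a b \<circ> p"
  have q: "?q permutes insert a S"
    using p b by (intro permutes_compose permutes_subset[OF p] permutes_swap_id) auto
  have "p a = a" using p S by (simp add: permutes_def)
  hence "b \<in> orbit ?q a" using orbit.base[of ?q a] by simp
  hence "orbit ?q a \<in> orbit ?q ` S"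
    using permutes_orbit_eq_iff[OF q, of b a] S b by auto
  hence "orbit ?q ` insert a S = orbit ?q ` S" by auto
  moreover have "(\<lambda>X. X \<inter> S) ` orbit ?q ` S = orbit p ` S"
    unfolding image_image using orbit_transpose_insert[OF p S(2) b] by (intro image_cong) auto
  moreover have "inj_on (\<lambda>X. X \<inter> S) (orbit ?q ` S)"
  proof (rule inj_onI, clarify)
    fix x y assume xy: "x \<in> S" "y \<in> S" and eq: "orbit ?q x \<inter> S = orbit ?q y \<inter> S"
    have "x \<in> orbit ?q x" using q S by (intro permutation_self_in_orbit) (auto simp: permutation_permutes)
    hence "x \<in> orbit ?q y" using xy eq by blast
    thus "orbit ?q x = orbit ?q y" using permutes_orbit_eq_iff[OF q, of x y] S xy by simp
  qed
  ultimately show ?thesis by (metis card_image)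
qed

lemma card_orbits_insert_fixed:
  assumes p: "p permutes S" and S: "finite S" "a \<notin> S"
  shows "card (orbit p ` insert a S) = Suc (card (orbit p ` S))"
proof -
  have "orbit p a = {a}" using p S by (simp add: orbit_eq_singleton_iff permutes_def)
  moreover have "orbit p x \<subseteq> S" if "x \<in> S" for x
    using p that by (rule permutes_orbit_subset)
  ultimately have "orbit p a \<notin> orbit p ` S" using S by auto
  thus ?thesis using S by simp
qed

text \<open>Each permutation of \<open>insert a S\<close> is uniquely
  \<open>transpose a b \<circ> p\<close> with \<open>p\<close> permuting \<open>S\<close>. The
  choice \<open>b = a\<close> makes \<open>a\<close> a new fixed point, and each of the
  \<open>card S\<close> other choices puts it into an existing cycle; this is the Stirling
  recurrence.\<close>

lemma card_permutations_orbits: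
  assumes "finite S"
  shows "card {p. p permutes S \<and> card (orbit p ` S) = j} = stirling (card S) j"
  using assms
proof (induction S arbitrary: j)
  case empty
  have "{p. p permutes ({} :: 'a set) \<and> card (orbit p ` {}) = j} = (if j = 0 then {id} else {})"
    by (auto simp: permutes_empty)
  thus ?case by (cases j) auto
next
  case (insert a S)
  let ?A = "{p. p permutes S \<and> Suc (card (orbit p ` S)) = j}"
  let ?B = "{p. p permutes S \<and> card (orbit p ` S) = j}"
  let ?f = "\<lambda>(b, p). transpose a b \<circ> p"
  have inj: "inj_on ?f (insert a S \<times> {p. p permutes S})"
  proof (rule inj_onI, clarify)
    fix b p c q
    assume "p permutes S" "q permutes S" and eq: "transpose a b \<circ> p = transpose a c \<circ> q"
    hence "p a = a" "q a = a" using insert by (auto simp: permutes_def)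
    hence "b = c" using fun_cong[OF eq, of a] by simp
    hence "transpose a b \<circ> (transpose a b \<circ> p) = transpose a b \<circ> (transpose a b \<circ> q)"
      using eq by simp
    thus "b = c \<and> p = q" using \<open>b = c\<close> by (simp add: o_assoc[symmetric] flip: o_assoc) (simp add: o_assoc)
  qed
  have "{p. p permutes insert a S \<and> card (orbit p ` insert a S) = j}
      = {p \<in> ?f ` {(b, p). b \<in> insert a S \<and> p \<in> {p. p permutes S}}. card (orbit p ` insert a S) = j}"
    unfolding permutes_insert[symmetric] by auto
  also have "\<dots> = ?f ` ({a} \<times> ?A \<union> S \<times> ?B)"
    using insert.hyps card_orbits_transpose_insert[of _ S a] card_orbits_insert_fixed[of _ S a]
    by (auto simp: image_iff)
  finally have "card {p. p permutes insert a S \<and> card (orbit p ` insert a S) = j}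
      = card (?f ` ({a} \<times> ?A \<union> S \<times> ?B))" by simp
  also have "\<dots> = card ({a} \<times> ?A \<union> S \<times> ?B)"
    by (rule card_image[OF inj_on_subset[OF inj]]) auto
  also have "\<dots> = card ({a} \<times> ?A) + card (S \<times> ?B)"
    using insert.hyps finite_permutations[of S] by (intro card_Un_disjoint) auto
  also have "\<dots> = card ?A + card S * stirling (card S) j"
    by (simp add: insert card_cartesian_product)
  also have "\<dots> = stirling (card (insert a S)) j"
    using insert by (cases j; cases "card S") auto
  finally show ?case .
qed

lemma num_cycle_perms_eq_stirling: "num_cycle_perms m j = stirling m j"
  unfolding num_cycle_perms_def by (subst card_permutations_orbits) auto

section \<open>Parent maps\<close>

definition parent_rel :: "('a \<Rightarrow> 'a option) \<Rightarrow> ('a \<times> 'a) set" where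
  "parent_rel f = {(v, w). f v = Some w}"

text \<open>A rank decreasing towards parents expresses acyclicity when \<open>V\<close> is finite.
  It gives induction directly, and the ranks of two pieces can be stacked when forests are glued. On
  \<open>V\<close> the value \<open>None\<close> marks a root; outside \<open>V\<close> it is
  forced, so that a forest has only one map.\<close>

definition parent_maps :: "'a set \<Rightarrow> ('a \<Rightarrow> 'a option) set" where
  "parent_maps V = {f. dom f \<subseteq> V \<and> ran f \<subseteq> V \<and> (\<exists>d :: 'a \<Rightarrow> nat. \<forall>v w. f v = Some w \<longrightarrow> d w < d v)}"

text \<open>The vertices reachable from \<open>v\<close>, itself included, are those on its path to
  the root, so no path has to be mentioned.\<close>

definition map_records :: "'a :: linorder set \<Rightarrow> ('a \<Rightarrow> 'a option) \<Rightarrow> 'a set" where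
  "map_records V f = {v \<in> V. \<forall>w. (v, w) \<in> (parent_rel f)\<^sup>* \<longrightarrow> w \<le> v}"

lemma parent_mapsD:
  assumes "f \<in> parent_maps V" "f v = Some w"
  shows "v \<in> V" "w \<in> V"
  using assms by (auto simp: parent_maps_def dom_def ran_def)

lemma parent_mapsI:
  fixes d :: "'a \<Rightarrow> nat"
  assumes "\<And>v w. f v = Some w \<Longrightarrow> v \<in> V \<and> w \<in> V \<and> d w < d v"
  shows "f \<in> parent_maps V"
  using assms by (auto simp: parent_maps_def dom_def ran_def intro: exI[of _ d])

lemma finite_parent_maps:
  assumes "finite V"
  shows "finite (parent_maps V)"
proof (rule finite_subset)
  show "parent_maps V \<subseteq> (\<Union>A\<in>Pow V. {f. dom f = A \<and> ran f \<subseteq> V})"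
    by (auto simp: parent_maps_def)
  show "finite (\<Union>A\<in>Pow V. {f. dom f = A \<and> ran f \<subseteq> V})"
  proof (rule finite_UN_I)
    fix A assume "A \<in> Pow V"
    hence "finite A" using assms by (auto intro: finite_subset)
    thus "finite {f. dom f = A \<and> ran f \<subseteq> V}" using assms by (rule finite_set_of_finite_maps)
  qed (use assms in simp)
qed

lemma parent_rel_closed:
  assumes "(v, w) \<in> (parent_rel f)\<^sup>*" "v \<in> V" "\<And>v w. v \<in> V \<Longrightarrow> f v = Some w \<Longrightarrow> w \<in> V"
  shows "w \<in> V"
  using assms(1)
proof (induction rule: rtrancl_induct)
  case (step y z)
  thus ?case using assms(3)[of y z] by (simp add: parent_rel_def)
qed (rule assms(2))

text \<open>Used to see that vertices not below \<open>n\<close> keep their ancestors when the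
  forest is cut at \<open>n\<close>.\<close>

lemma parent_rel_cong:
  assumes "v \<in> V" and closed: "\<And>v w. v \<in> V \<Longrightarrow> f v = Some w \<Longrightarrow> w \<in> V"
    and eq: "\<And>v. v \<in> V \<Longrightarrow> f v = g v"
  shows "(v, w) \<in> (parent_rel f)\<^sup>* \<longleftrightarrow> (v, w) \<in> (parent_rel g)\<^sup>*"
proof -
  have "(v, w) \<in> (parent_rel g)\<^sup>*" if "(v, w) \<in> (parent_rel f)\<^sup>*"
    using that
  proof (induction rule: rtrancl_induct)
    case (step y z)
    hence "y \<in> V" using parent_rel_closed[of v y f V] step(1) \<open>v \<in> V\<close> closed by blast
    hence "(y, z) \<in> parent_rel g" using step eq[of y] by (simp add: parent_rel_def)
    thus ?case using step by (meson rtrancl_into_rtrancl)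
  qed simp
  moreover have "(v, w) \<in> (parent_rel f)\<^sup>*" if "(v, w) \<in> (parent_rel g)\<^sup>*"
    using that
  proof (induction rule: rtrancl_induct)
    case (step y z)
    hence "y \<in> V" using parent_rel_closed[of v y f V] step(3) \<open>v \<in> V\<close> closed by blast
    hence "(y, z) \<in> parent_rel f" using step eq[of y] by (simp add: parent_rel_def)
    thus ?case using step by (meson rtrancl_into_rtrancl)
  qed simp
  ultimately show ?thesis by blast
qed

text \<open>
  A forest on \<open>insert n V\<close> is cut into the set \<open>D\<close> of descendants of \<open>n\<close>, the forest \<open>g\<close> that they form
  below \<open>n\<close>, the forest \<open>h\<close> on the remaining vertices, and the parent \<open>p\<close> of \<open>n\<close>.
\<close>

definition attach :: "'a \<Rightarrow> 'a set \<times> ('a \<Rightarrow> 'a option) \<times> ('a \<Rightarrow> 'a option) \<times> 'a option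
    \<Rightarrow> 'a \<Rightarrow> 'a option" where
  "attach n = (\<lambda>(D, g, h, p) v. if v = n then p
     else if v \<in> D then Some (case g v of None \<Rightarrow> n | Some w \<Rightarrow> w) else h v)"

definition detach :: "'a \<Rightarrow> 'a set \<Rightarrow> ('a \<Rightarrow> 'a option)
    \<Rightarrow> 'a set \<times> ('a \<Rightarrow> 'a option) \<times> ('a \<Rightarrow> 'a option) \<times> 'a option" where
  "detach n V f = (let D = {v \<in> V. (v, n) \<in> (parent_rel f)\<^sup>*} in
     (D, \<lambda>v. if v \<in> D \<and> f v \<noteq> Some n then f v else None, f |` (V - D), f n))"

text \<open>A parent of \<open>n\<close> inside \<open>D\<close> would close a cycle, so it is taken
  from \<open>V - D\<close>; with \<open>None\<close>, for \<open>n\<close> a root, this leaves one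
  choice more than \<open>V - D\<close> has elements.\<close>

definition splittings where
  "splittings V = (SIGMA D:Pow V. parent_maps D \<times> parent_maps (V - D) \<times> insert None (Some ` (V - D)))"

context
  fixes V :: "'a set" and n :: 'a
  assumes V: "finite V" "n \<notin> V"
begin

context
  fixes D g h p f
  assumes t: "(D, g, h, p) \<in> splittings V"
  defines "f \<equiv> attach n (D, g, h, p)"
begin

private lemma D: "D \<subseteq> V" and g: "g \<in> parent_maps D" and h: "h \<in> parent_maps (V - D)"
  and p: "p = None \<or> (\<exists>w \<in> V - D. p = Some w)"
  using t by (auto simp: splittings_def)

private lemma f_n: "f n = p"
  and f_D: "v \<in> D \<Longrightarrow> f v = Some (case g v of None \<Rightarrow> n | Some w \<Rightarrow> w)"
  and f_h: "v \<in> V - D \<Longrightarrow> f v = h v"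
  and f_out: "v \<notin> insert n V \<Longrightarrow> f v = None"
  using D V h by (auto simp: f_def attach_def parent_maps_def dom_def)

lemma attach_closed: "v \<in> V - D \<Longrightarrow> f v = Some w \<Longrightarrow> w \<in> V - D"
  using h f_h by (auto dest: parent_mapsD)

lemma attach_in_parent_maps: "f \<in> parent_maps (insert n V)"
proof -
  obtain dg :: "'a \<Rightarrow> nat" where dg: "\<And>v w. g v = Some w \<Longrightarrow> dg w < dg v"
    using g by (auto simp: parent_maps_def)
  obtain dh :: "'a \<Rightarrow> nat" where dh: "\<And>v w. h v = Some w \<Longrightarrow> dh w < dh v"
    using h by (auto simp: parent_maps_def)
  define M where "M = (\<Sum>v\<in>V. dh v)"
  have M: "dh v \<le> M" if "v \<in> V" for v
    unfolding M_def using that V by (intro member_le_sum) auto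
  \<comment> \<open>Three layers are stacked: the vertices outside \<open>D\<close> with ranks at
    most \<open>M\<close>, then \<open>n\<close>, then \<open>D\<close>. Each parent link stays in
    its layer, where the old rank decreases, or descends to a lower one.\<close>
  define d where "d v = (if v = n then Suc M else if v \<in> D then Suc (Suc (M + dg v)) else dh v)" for v
  show ?thesis
  proof (rule parent_mapsI)
    fix v w assume vw: "f v = Some w"
    consider "v = n" | "v \<in> D" "g v = None" | u where "v \<in> D" "g v = Some u" | "v \<in> V - D"
      using vw f_out[of v] by fastforce
    thus "v \<in> insert n V \<and> w \<in> insert n V \<and> d w < d v"
    proof cases
      case 1
      thus ?thesis using vw f_n p M V D by (auto simp: d_def intro: le_imp_less_Suc)
    next
      case 2
      thus ?thesis using vw f_D[of v] V D by (auto simp: d_def)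
    next
      case 3
      thus ?thesis using vw f_D[of v] V D dg[of v u] parent_mapsD[OF g, of v u] by (auto simp: d_def)
    next
      case 4
      thus ?thesis using vw f_h[of v] V D dh[of v w] parent_mapsD[OF h, of v w] by (auto simp: d_def)
    qed
  qed
qed

lemma attach_descendant: "v \<in> D \<Longrightarrow> (v, n) \<in> (parent_rel f)\<^sup>*"
proof -
  obtain dg :: "'a \<Rightarrow> nat" where dg: "\<And>v w. g v = Some w \<Longrightarrow> dg w < dg v"
    using g by (auto simp: parent_maps_def)
  show "v \<in> D \<Longrightarrow> (v, n) \<in> (parent_rel f)\<^sup>*"
  proof (induction "dg v" arbitrary: v rule: less_induct)
    case less
    show ?case
    proof (cases "g v")
      case None
      thus ?thesis using less f_D[of v] by (auto simp: parent_rel_def)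
    next
      case (Some w)
      hence "(w, n) \<in> (parent_rel f)\<^sup>*" using less dg g by (auto dest: parent_mapsD)
      moreover have "(v, w) \<in> parent_rel f" using less Some f_D[of v] by (auto simp: parent_rel_def)
      ultimately show ?thesis by (rule converse_rtrancl_into_rtrancl[rotated])
    qed
  qed
qed

text \<open>No further vertex of \<open>V\<close> reaches \<open>n\<close>, because
  \<open>V - D\<close> is closed under \<open>f\<close> and \<open>n\<close> lies outside
  \<open>V\<close>.\<close>

lemma attach_descendants: "{v \<in> V. (v, n) \<in> (parent_rel f)\<^sup>*} = D"
proof -
  have "n \<in> V - D" if "v \<in> V - D" "(v, n) \<in> (parent_rel f)\<^sup>*" for v
    using parent_rel_closed[OF that(2,1)] attach_closed by blast
  thus ?thesis using V D attach_descendant by auto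
qed

lemma detach_attach: "detach n V f = (D, g, h, p)"
proof -
  \<comment> \<open>The parent \<open>n\<close> marks the roots of \<open>g\<close> unambiguously,
    since the values of \<open>g\<close> lie in \<open>D\<close>, which does not contain
    \<open>n\<close>.\<close>
  have "(\<lambda>v. if v \<in> D \<and> f v \<noteq> Some n then f v else None) = g"
  proof
    fix v
    have "g v = None" if "v \<notin> D" using g that by (auto simp: parent_maps_def dom_def)
    thus "(if v \<in> D \<and> f v \<noteq> Some n then f v else None) = g v"
      using f_D[of v] D V parent_mapsD(2)[OF g, of v]
      by (cases "v \<in> D"; cases "g v") auto
  qed
  moreover have "f |` (V - D) = h"
  proof
    fix v
    have "h v = None" if "v \<notin> V - D" using h that by (auto simp: parent_maps_def dom_def)
    thus "(f |` (V - D)) v = h v"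
      using f_h[of v] by (auto simp: restrict_map_def)
  qed
  ultimately show ?thesis by (simp add: detach_def attach_descendants f_n)
qed

end

lemma detach_in_splittings:
  assumes f: "f \<in> parent_maps (insert n V)"
  shows "detach n V f \<in> splittings V" and "attach n (detach n V f) = f"
proof -
  define D where "D = {v \<in> V. (v, n) \<in> (parent_rel f)\<^sup>*}"
  define g where "g = (\<lambda>v. if v \<in> D \<and> f v \<noteq> Some n then f v else None)"
  have detach: "detach n V f = (D, g, f |` (V - D), f n)"
    by (simp add: detach_def D_def g_def Let_def)
  obtain d :: "'a \<Rightarrow> nat" where d: "\<And>v w. f v = Some w \<Longrightarrow> d w < d v"
    using f by (auto simp: parent_maps_def)
  have d_mono: "d w \<le> d v" if "(v, w) \<in> (parent_rel f)\<^sup>*" for v w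
    using that by (induction rule: rtrancl_induct) (auto simp: parent_rel_def dest: d)
  \<comment> \<open>A vertex has only one parent, so the path from \<open>v\<close> to
    \<open>n\<close> has to continue through \<open>w\<close>.\<close>
  have up: "w \<in> D" if "v \<in> D" "f v = Some w" "w \<noteq> n" for v w
  proof -
    have "(v, n) \<in> (parent_rel f)\<^sup>*" "v \<noteq> n" using that V by (auto simp: D_def)
    then obtain u where "(v, u) \<in> parent_rel f" "(u, n) \<in> (parent_rel f)\<^sup>*"
      by (meson converse_rtranclE)
    thus ?thesis using that parent_mapsD[OF f that(2)] by (auto simp: D_def parent_rel_def)
  qed
  have down: "w \<in> V - D" if "v \<in> V - D" "f v = Some w" for v w
  proof -
    have "(v, w) \<in> parent_rel f" using that by (auto simp: parent_rel_def)
    hence "(w, n) \<notin> (parent_rel f)\<^sup>*"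
      using that converse_rtrancl_into_rtrancl[of v w "parent_rel f" n] by (auto simp: D_def)
    thus ?thesis using parent_mapsD[OF f that(2)] by (auto simp: D_def)
  qed
  have "g \<in> parent_maps D"
  proof (rule parent_mapsI)
    fix v w assume "g v = Some w"
    hence "v \<in> D" "f v = Some w" "w \<noteq> n" by (auto simp: g_def split: if_splits)
    thus "v \<in> D \<and> w \<in> D \<and> d w < d v" using up[of v w] d[of v w] by blast
  qed
  moreover have "f |` (V - D) \<in> parent_maps (V - D)"
  proof (rule parent_mapsI)
    fix v w assume "(f |` (V - D)) v = Some w"
    hence "v \<in> V - D" "f v = Some w" by (auto simp: restrict_map_def split: if_splits)
    thus "v \<in> V - D \<and> w \<in> V - D \<and> d w < d v" using down[of v w] d[of v w] by blast
  qed
  moreover have "f n \<in> insert None (Some ` (V - D))"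
  proof (cases "f n")
    case (Some w)
    \<comment> \<open>If the parent \<open>w\<close> of \<open>n\<close> were in \<open>D\<close>,
      its rank would be at least that of \<open>n\<close>, whereas ranks decrease towards
      parents.\<close>
    hence "w \<noteq> n" "w \<notin> D" using d d_mono by (fastforce simp: D_def)+
    thus ?thesis using Some parent_mapsD[OF f Some] by auto
  qed simp
  ultimately show "detach n V f \<in> splittings V"
    unfolding detach splittings_def by (auto simp: D_def)
  show "attach n (detach n V f) = f"
  proof
    fix v
    have "f v \<noteq> None" if "v \<in> D"
    proof -
      from that have "(v, n) \<in> (parent_rel f)\<^sup>*" "v \<noteq> n" using V by (auto simp: D_def)
      then obtain u where "(v, u) \<in> parent_rel f" by (meson converse_rtranclE)
      thus ?thesis by (simp add: parent_rel_def)
    qed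
    moreover have "f v = None" if "v \<notin> insert n V" using f that by (auto simp: parent_maps_def dom_def)
    moreover have "D \<subseteq> V" by (auto simp: D_def)
    ultimately show "attach n (detach n V f) v = f v"
      unfolding detach attach_def by (auto simp: g_def restrict_map_def split: option.splits)
  qed
qed

end

lemma map_records_attach:
  assumes V: "finite V" "\<And>v. v \<in> V \<Longrightarrow> v < n" and t: "(D, g, h, p) \<in> splittings V"
  shows "map_records (insert n V) (attach n (D, g, h, p)) = insert n (map_records (V - D) h)"
proof -
  let ?f = "attach n (D, g, h, p)"
  have n: "n \<notin> V" using V by auto
  note f = attach_in_parent_maps[OF V(1) n t]
  have D: "D \<subseteq> V" using t by (auto simp: splittings_def)
  have n_le: "w \<le> n" if "(n, w) \<in> (parent_rel ?f)\<^sup>*" for w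
  proof -
    have "w \<in> insert n V" using parent_rel_closed[OF that, of "insert n V"] parent_mapsD(2)[OF f] by blast
    thus ?thesis using V(2)[of w] by (auto intro: less_imp_le)
  qed
  have D_le: "\<exists>w. (v, w) \<in> (parent_rel ?f)\<^sup>* \<and> \<not> w \<le> v" if "v \<in> D" for v
  proof -
    have "v < n" using that D V(2) by blast
    thus ?thesis using attach_descendant[OF V(1) n t that] by (auto simp: not_le)
  qed
  \<comment> \<open>The complement of \<open>D\<close> is closed under the attached map, so these
    vertices never meet \<open>n\<close> among their ancestors.\<close>
  have rest: "(v, w) \<in> (parent_rel ?f)\<^sup>* \<longleftrightarrow> (v, w) \<in> (parent_rel h)\<^sup>*" if "v \<in> V - D" for v w
    using that
  proof (rule parent_rel_cong)
    show "w \<in> V - D" if "v \<in> V - D" "?f v = Some w" for v w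
      by (rule attach_closed[OF V(1) n t that])
    show "?f v = h v" if "v \<in> V - D" for v
      using that n by (auto simp: attach_def)
  qed
  show ?thesis
  proof (rule set_eqI)
    fix v
    consider "v = n" | "v \<in> D" | "v \<in> V - D" | "v \<notin> insert n V" using D by blast
    thus "v \<in> map_records (insert n V) ?f \<longleftrightarrow> v \<in> insert n (map_records (V - D) h)"
    proof cases
      case 1
      thus ?thesis using n_le by (simp add: map_records_def)
    next
      case 2
      hence "v \<noteq> n" using D n by auto
      thus ?thesis using 2 D_le[OF 2] by (auto simp: map_records_def)
    next
      case 3
      hence "v \<noteq> n" using n by auto
      thus ?thesis using 3 rest[OF 3] by (simp add: map_records_def)
    next
      case 4
      thus ?thesis by (auto simp: map_records_def)
    qed
  qed
qed

section \<open>The recurrence for the generating polynomial of parent maps\<close>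

definition record_gf :: "'a :: linorder set \<Rightarrow> real poly" where
  "record_gf V = (\<Sum>f\<in>parent_maps V. monom 1 (card (map_records V f)))"

lemma card_parent_maps: "real (card (parent_maps V)) = poly (record_gf V) 1"
  for V :: "'a :: linorder set"
  by (simp add: record_gf_def poly_sum poly_monom)

lemma sum_Pow_card:
  fixes F :: "nat \<Rightarrow> real poly"
  assumes "finite V"
  shows "(\<Sum>D\<in>Pow V. F (card D)) = (\<Sum>s\<le>card V. smult (real (card V choose s)) (F s))"
proof -
  have "(\<Sum>D\<in>Pow V. F (card D)) = (\<Sum>s\<le>card V. \<Sum>D\<in>{D \<in> Pow V. card D = s}. F (card D))"
    using assms by (intro sum.group[symmetric]) (auto intro: card_mono)
  also have "\<dots> = (\<Sum>s\<le>card V. smult (real (card V choose s)) (F s))"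
  proof (intro sum.cong refl)
    fix s
    have "(\<Sum>D\<in>{D \<in> Pow V. card D = s}. F (card D)) = (\<Sum>D\<in>{D \<in> Pow V. card D = s}. F s)"
      by (intro sum.cong) auto
    also have "\<dots> = smult (real (card V choose s)) (F s)"
      using n_subsets[OF assms, of s] by (simp add: of_nat_poly)
    finally show "(\<Sum>D\<in>{D \<in> Pow V. card D = s}. F (card D)) = smult (real (card V choose s)) (F s)" .
  qed
  finally show ?thesis .
qed

lemma record_gf_insert:
  assumes V: "finite V" "\<And>v. v \<in> V \<Longrightarrow> v < n"
  shows "record_gf (insert n V) = (\<Sum>D\<in>Pow V. smult (real (card (parent_maps D)) * (real (card (V - D)) + 1))
    ([:0, 1:] * record_gf (V - D)))"
proof -
  have n: "n \<notin> V" using V by auto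
  have fin: "finite (V - D)" for D using V by simp
  have "record_gf (insert n V)
    = (\<Sum>(D, g, h, p)\<in>splittings V. monom 1 (Suc (card (map_records (V - D) h))))"
    unfolding record_gf_def
  proof (rule sum.reindex_bij_witness[of _ "attach n" "detach n V"])
    fix t assume t: "t \<in> splittings V"
    obtain D g h p where [simp]: "t = (D, g, h, p)" by (cases t) auto
    show "detach n V (attach n t) = t" "attach n t \<in> parent_maps (insert n V)"
      using detach_attach[OF V(1) n] attach_in_parent_maps[OF V(1) n] t by auto
  next
    fix f assume f: "f \<in> parent_maps (insert n V)"
    show 1: "attach n (detach n V f) = f" and 2: "detach n V f \<in> splittings V"
      using detach_in_splittings[OF V(1) n f] by auto
    obtain D g h p where t: "detach n V f = (D, g, h, p)" by (cases "detach n V f") auto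
    have "map_records (insert n V) f = insert n (map_records (V - D) h)"
      using map_records_attach[OF V, of D g h p] 1 2 t by simp
    moreover have "n \<notin> map_records (V - D) h" "finite (map_records (V - D) h)"
      using V n by (auto simp: map_records_def)
    ultimately show "(case detach n V f of (D, g, h, p) \<Rightarrow> monom 1 (Suc (card (map_records (V - D) h))))
      = (monom 1 (card (map_records (insert n V) f)) :: real poly)"
      by (simp add: t)
  qed
  also have "\<dots> = (\<Sum>D\<in>Pow V. \<Sum>g\<in>parent_maps D. \<Sum>h\<in>parent_maps (V - D).
      \<Sum>p\<in>insert None (Some ` (V - D)). monom 1 (Suc (card (map_records (V - D) h))))"
    unfolding splittings_def using V
    by (simp add: sum.Sigma[symmetric] sum.cartesian_product[symmetric] finite_parent_maps finite_subset
        cong: sum.cong)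
  also have "\<dots> = (\<Sum>D\<in>Pow V. smult (real (card (parent_maps D)) * (real (card (V - D)) + 1))
    ([:0, 1:] * record_gf (V - D)))"
  proof (intro sum.cong refl)
    fix D
    have "card (insert None (Some ` (V - D))) = Suc (card (V - D))"
      using fin by (subst card_insert_disjoint) (auto simp: card_image)
    hence "(\<Sum>p\<in>insert None (Some ` (V - D)). monom 1 (Suc k))
      = smult (real (card (V - D)) + 1) ([:0, 1:] * monom 1 k)" for k
      by (simp add: of_nat_poly monom_Suc add.commute)
    hence "(\<Sum>h\<in>parent_maps (V - D). \<Sum>p\<in>insert None (Some ` (V - D)).
        monom 1 (Suc (card (map_records (V - D) h))))
      = smult (real (card (V - D)) + 1) ([:0, 1:] * record_gf (V - D))"
      by (simp only: record_gf_def sum_distrib_left smult_sum_right)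
    thus "(\<Sum>g\<in>parent_maps D. \<Sum>h\<in>parent_maps (V - D).
        \<Sum>p\<in>insert None (Some ` (V - D)). monom 1 (Suc (card (map_records (V - D) h))))
      = smult (real (card (parent_maps D)) * (real (card (V - D)) + 1)) ([:0, 1:] * record_gf (V - D))"
      by (simp add: of_nat_poly mult.commute)
  qed
  finally show ?thesis .
qed

text \<open>With the maximum removed, the descendants \<open>D\<close> and the rest
  \<open>W - D\<close> both have fewer vertices than \<open>V\<close>. The induction hypothesis is
  used twice: as a polynomial for \<open>W - D\<close>, and at \<open>x = 1\<close> to count the
  forests on \<open>D\<close>.\<close>

lemma record_gf_eq:
  assumes "finite V"
  shows "record_gf V = record_poly (card V)"
  using assms
proof (induction "card V" arbitrary: V rule: less_induct)
  case less
  show ?case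
  proof (cases "V = {}")
    case True
    have "parent_maps ({} :: 'a set) = {Map.empty}" by (auto simp: parent_maps_def)
    thus ?thesis using True by (simp add: record_gf_def map_records_def)
  next
    case False
    define n where "n = Max V"
    define W where "W = V - {n}"
    have "n \<in> V" using False less.prems by (simp add: n_def)
    hence V: "V = insert n W" "finite W" "n \<notin> W"
      using less.prems by (auto simp: W_def)
    have lt: "v < n" if "v \<in> W" for v
      using that less.prems by (auto simp: W_def n_def intro: le_neq_trans)
    have card: "card V = Suc (card W)" using V by simp
    let ?F = "\<lambda>s. smult ((real s + 1) ^ (s - 1) * (real (card W - s) + 1)) ([:0, 1:] * record_poly (card W - s))"
    have "record_gf V = (\<Sum>D\<in>Pow W. smult (real (card (parent_maps D)) * (real (card (W - D)) + 1))
      ([:0, 1:] * record_gf (W - D)))"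
      unfolding V(1) by (rule record_gf_insert[OF V(2) lt])
    also have "\<dots> = (\<Sum>D\<in>Pow W. ?F (card D))"
    proof (intro sum.cong refl)
      fix D assume "D \<in> Pow W"
      hence D: "D \<subseteq> W" "finite D" using V by (auto intro: finite_subset)
      hence "card D \<le> card W" "card (W - D) = card W - card D"
        using V by (auto intro: card_mono simp: card_Diff_subset)
      moreover from this have "record_gf D = record_poly (card D)"
        using D card by (intro less.hyps) auto
      moreover have "record_gf (W - D) = record_poly (card (W - D))"
        using calculation V card by (intro less.hyps) auto
      ultimately show "smult (real (card (parent_maps D)) * (real (card (W - D)) + 1))
          ([:0, 1:] * record_gf (W - D)) = ?F (card D)"
        by (simp add: card_parent_maps poly_record_poly_1)
    qed
    also have "\<dots> = (\<Sum>s\<le>card W. smult (real (card W choose s)) (?F s))"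
      by (rule sum_Pow_card[OF V(2)])
    also have "\<dots> = record_poly (card V)"
      unfolding card record_poly_Suc sum_distrib_left by (intro sum.cong refl) (simp add: mult_ac)
    finally show ?thesis .
  qed
qed

section \<open>Rooted forests and parent maps\<close>

definition is_chain :: "('a \<Rightarrow> 'a option) \<Rightarrow> 'a list \<Rightarrow> bool" where
  "is_chain f = successively (\<lambda>v w. f v = Some w)"

lemma walk_eq_successively: "walk E = successively (\<lambda>u v. {u, v} \<in> E)"
  by (auto simp: walk_def successively_conv_nth fun_eq_iff)

lemma walk_rev: "walk E (rev p) \<longleftrightarrow> walk E p"
  by (simp add: walk_eq_successively insert_commute)

text \<open>For a root \<open>r\<close> it suffices to require that the child \<open>v\<close> of an
  edge reaches \<open>r\<close>: then \<open>v\<close> differs from \<open>r\<close>, and its parent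
  reaches \<open>r\<close> too.\<close>

definition component :: "'a set \<Rightarrow> ('a \<Rightarrow> 'a option) \<Rightarrow> 'a \<Rightarrow> 'a rooted_graph" where
  "component V f r = Rooted_Graph {v \<in> V. (v, r) \<in> (parent_rel f)\<^sup>*}
     {{v, w} | v w. f v = Some w \<and> (v, r) \<in> (parent_rel f)\<^sup>*} r"

definition forest_of :: "'a set \<Rightarrow> ('a \<Rightarrow> 'a option) \<Rightarrow> 'a rooted_graph set" where
  "forest_of V f = component V f ` {r \<in> V. f r = None}"

text \<open>The cut is at the first vertex \<open>w\<close> of \<open>p\<close> that lies on
  \<open>q\<close>, which exists because both paths end at \<open>r\<close>. The part of
  \<open>p\<close> before \<open>w\<close> then avoids \<open>q\<close>, so the joined walk repeats
  no vertex.\<close>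

lemma join_paths:
  assumes p: "path_between V E u p r" and q: "path_between V E v q r"
  obtains p1 q1 p2 q2 w where "p = p1 @ w # p2" "q = q1 @ w # q2"
    "path_between V E u (p1 @ w # rev q1) v"
proof -
  have "r \<in> set p" "r \<in> set q" using p q by (metis last_in_set path_between_def)+
  hence "\<exists>x\<in>set p. x \<in> set q" by blast
  then obtain p1 w p2 where p1: "p = p1 @ w # p2" "w \<in> set q" "\<forall>x\<in>set p1. x \<notin> set q"
    by (rule split_list_first_propE)
  then obtain q1 q2 where q1: "q = q1 @ w # q2" by (meson split_list)
  have "walk E (p1 @ [w])" "walk E (q1 @ [w])"
    using p q unfolding p1(1) q1 path_between_def walk_eq_successively
    by (auto simp: successively_append_iff successively_Cons)
  hence "walk E (p1 @ [w])" "walk E (w # rev q1)"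
    using walk_rev[of E "q1 @ [w]"] by auto
  hence "walk E (p1 @ w # rev q1)"
    unfolding walk_eq_successively by (auto simp: successively_append_iff successively_Cons)
  moreover have "hd (p1 @ w # rev q1) = u" using p p1(1) by (cases p1) (auto simp: path_between_def)
  moreover have "last (p1 @ w # rev q1) = v" using q q1 by (cases q1) (auto simp: path_between_def)
  moreover have "distinct (p1 @ w # rev q1)"
    using p q p1 q1 by (auto simp: path_between_def)
  moreover have "set (p1 @ w # rev q1) \<subseteq> V"
    using p q p1 q1 by (auto simp: path_between_def)
  ultimately have "path_between V E u (p1 @ w # rev q1) v"
    by (simp add: path_between_def)
  thus thesis using that p1(1) q1 by blast
qed

text \<open>If neither path started with the edge \<open>{u, v}\<close>, joining them would close a cycle.\<close>

lemma tree_edge_on_path: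
  assumes "tree V E" and p: "path_between V E u p r" and q: "path_between V E v q r"
    and uv: "{u, v} \<in> E"
  shows "(\<exists>s. p = u # v # s) \<or> (\<exists>s. q = v # u # s)"
proof -
  obtain p1 q1 p2 q2 w where split: "p = p1 @ w # p2" "q = q1 @ w # q2"
    and path: "path_between V E u (p1 @ w # rev q1) v"
    using join_paths[OF p q] .
  let ?c = "p1 @ w # rev q1"
  have "\<not> cycle V E ?c" using assms by (auto simp: tree_def)
  moreover have "{last ?c, hd ?c} \<in> E" using path uv by (simp add: path_between_def insert_commute)
  ultimately have "length ?c < 3" using path by (auto simp: cycle_def path_between_def)
  moreover have "u \<noteq> v"
    using uv assms(1) by (fastforce simp: tree_def simple_graph_def doubleton_eq_iff)
  moreover have "hd ?c = u" "last ?c = v" using path by (auto simp: path_between_def)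
  \<comment> \<open>The joined path consists of \<open>u\<close> and \<open>v\<close> alone, so the
    meeting point is one of them: \<open>w = v\<close> makes \<open>p\<close> start with the edge,
    \<open>w = u\<close> makes \<open>q\<close> do so.\<close>
  ultimately consider a where "p1 = [a]" "q1 = []" "a = u" "w = v"
    | a where "p1 = []" "q1 = [a]" "w = u" "a = v"
    by (cases p1; cases q1) auto
  thus ?thesis using split by cases auto
qed

section \<open>Trees cut out by a parent map\<close>

context
  fixes V :: "'a set" and f :: "'a \<Rightarrow> 'a option"
  assumes f: "f \<in> parent_maps V"
begin

private definition rank :: "'a \<Rightarrow> nat" where
  "rank = (SOME d. \<forall>v w. f v = Some w \<longrightarrow> d w < d v)"

private lemma rank: "f v = Some w \<Longrightarrow> rank w < rank v"
  unfolding rank_def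
  by (rule someI2_ex[where P = "\<lambda>d. \<forall>v w. f v = Some w \<longrightarrow> d w < d v"])
     (use f in \<open>auto simp: parent_maps_def\<close>)

private lemma rank_le: "(v, w) \<in> (parent_rel f)\<^sup>* \<Longrightarrow> rank w \<le> rank v"
  by (induction rule: rtrancl_induct) (auto simp: parent_rel_def dest: rank)

lemma parent_rel_step:
  assumes "f v = Some w" "f r = None" "(v, r) \<in> (parent_rel f)\<^sup>*"
  shows "(w, r) \<in> (parent_rel f)\<^sup>*"
proof -
  have "v \<noteq> r" using assms by auto
  then obtain x where "(v, x) \<in> parent_rel f" "(x, r) \<in> (parent_rel f)\<^sup>*"
    using assms(3) by (meson converse_rtranclE)
  thus ?thesis using assms(1) by (simp add: parent_rel_def)
qed

lemma root_exists:
  assumes "v \<in> V"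
  obtains r where "r \<in> V" "f r = None" "(v, r) \<in> (parent_rel f)\<^sup>*"
proof -
  have "\<exists>r\<in>V. f r = None \<and> (v, r) \<in> (parent_rel f)\<^sup>*"
    using assms
  proof (induction "rank v" arbitrary: v rule: less_induct)
    case less
    show ?case
    proof (cases "f v")
      case None
      thus ?thesis using less.prems by auto
    next
      case (Some w)
      then obtain r where "r \<in> V" "f r = None" "(w, r) \<in> (parent_rel f)\<^sup>*"
        using less.hyps[of w] rank[OF Some] parent_mapsD[OF f Some] by blast
      moreover have "(v, w) \<in> parent_rel f" using Some by (simp add: parent_rel_def)
      ultimately show ?thesis by (meson converse_rtrancl_into_rtrancl)
    qed
  qed
  thus thesis using that by blast
qed

lemma root_reaches_itself_only:
  assumes "f r = None" "(r, w) \<in> (parent_rel f)\<^sup>*"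
  shows "w = r"
  using assms(2,1) by (cases rule: converse_rtranclE) (auto simp: parent_rel_def)

lemma root_unique:
  assumes "(v, r) \<in> (parent_rel f)\<^sup>*" "(v, r') \<in> (parent_rel f)\<^sup>*" "f r = None" "f r' = None"
  shows "r = r'"
  using assms
proof (induction rule: converse_rtrancl_induct)
  case base
  thus ?case using root_reaches_itself_only by metis
next
  case (step v w)
  thus ?case using parent_rel_step[of v w r'] by (simp add: parent_rel_def)
qed

lemma chain_exists:
  assumes "(v, r) \<in> (parent_rel f)\<^sup>*"
  shows "\<exists>p. p \<noteq> [] \<and> hd p = v \<and> last p = r \<and> distinct p \<and> is_chain f p
    \<and> (\<forall>x\<in>set p. (v, x) \<in> (parent_rel f)\<^sup>* \<and> (x, r) \<in> (parent_rel f)\<^sup>*)"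
  using assms
proof (induction rule: converse_rtrancl_induct)
  case base
  show ?case by (rule exI[of _ "[r]"]) (simp add: is_chain_def)
next
  case (step v w)
  then obtain p where p: "p \<noteq> []" "hd p = w" "last p = r" "distinct p" "is_chain f p"
    and reach: "\<And>x. x \<in> set p \<Longrightarrow> (w, x) \<in> (parent_rel f)\<^sup>*" "\<And>x. x \<in> set p \<Longrightarrow> (x, r) \<in> (parent_rel f)\<^sup>*"
    by blast
  have vw: "f v = Some w" using step by (simp add: parent_rel_def)
  have "v \<notin> set p" using rank_le[OF reach(1), of v] rank[OF vw] by auto
  moreover have "is_chain f (v # p)" using p vw by (simp add: is_chain_def successively_Cons)
  moreover have "(v, x) \<in> (parent_rel f)\<^sup>*" if "x \<in> set p" for x
    using step(1) reach(1)[OF that] by (rule converse_rtrancl_into_rtrancl)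
  moreover have "(v, r) \<in> (parent_rel f)\<^sup>*"
    using step(1,2) by (rule converse_rtrancl_into_rtrancl)
  ultimately show ?case using p reach(2) by (intro exI[of _ "v # p"]) auto
qed

lemma component_no_cycle: "\<not> cycle (verts (component V f r)) (edges (component V f r)) p"
proof
  assume c: "cycle (verts (component V f r)) (edges (component V f r)) p"
  define n where "n = length p"
  have n: "n \<ge> 3" and dist: "distinct p" using c by (auto simp: cycle_def n_def)
  have edge: "f u = Some v \<or> f v = Some u" if "{u, v} \<in> edges (component V f r)" for u v
    using that by (auto simp: component_def doubleton_eq_iff)
  define next_ix where "next_ix i = (if Suc i = n then 0 else Suc i)" for i
  have next_edge: "f (p ! i) = Some (p ! next_ix i) \<or> f (p ! next_ix i) = Some (p ! i)" if "i < n" for i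
  proof (cases "Suc i = n")
    case True
    hence "p \<noteq> []" "i = length p - 1" using n by (auto simp: n_def)
    hence "p ! i = last p" "p ! 0 = hd p" by (simp_all add: last_conv_nth hd_conv_nth)
    thus ?thesis using edge c True by (simp add: cycle_def next_ix_def)
  next
    case False
    hence "{p ! i, p ! Suc i} \<in> edges (component V f r)"
      using c that by (auto simp: cycle_def walk_def n_def)
    thus ?thesis using edge False by (simp add: next_ix_def)
  qed
  \<comment> \<open>At a vertex of maximal rank both neighbours on the cycle are its parent.\<close>
  obtain i where i: "i < n" "\<And>j. j < n \<Longrightarrow> rank (p ! j) \<le> rank (p ! i)"
  proof -
    have "Max ((\<lambda>i. rank (p ! i)) ` {..<n}) \<in> (\<lambda>i. rank (p ! i)) ` {..<n}"
      using n by (intro Max_in) (auto simp: lessThan_empty_iff)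
    then obtain i where "i < n" "rank (p ! i) = Max ((\<lambda>i. rank (p ! i)) ` {..<n})" by auto
    thus thesis using that[of i] by (auto intro: Max_ge)
  qed
  have not_up: "f (p ! j) \<noteq> Some (p ! i)" if "j < n" for j
    using i(2)[OF that] rank[of "p ! j" "p ! i"] by auto
  \<comment> \<open>The cyclic predecessor of \<open>i\<close>. Length at least \<open>3\<close>
    makes it different from the cyclic successor, so the vertex at \<open>i\<close> would have two
    distinct parents.\<close>
  define k where "k = (if i = 0 then n - 1 else i - 1)"
  have k: "k < n" "next_ix k = i" using i n by (auto simp: k_def next_ix_def)
  have next_i: "next_ix i < n" "next_ix i \<noteq> k" using i n by (auto simp: k_def next_ix_def)
  have "f (p ! i) = Some (p ! next_ix i)" using next_edge[OF i(1)] not_up[OF next_i(1)] by blast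
  moreover have "f (p ! i) = Some (p ! k)" using next_edge[OF k(1)] not_up[OF k(1)] k(2) by auto
  ultimately show False using dist next_i k(1) by (simp add: nth_eq_iff_index_eq n_def)
qed

lemma component_rooted_tree:
  assumes "finite V" "r \<in> V" "f r = None"
  shows "rooted_tree (component V f r)"
proof -
  let ?W = "verts (component V f r)" and ?E = "edges (component V f r)"
  have edge: "v \<in> ?W \<and> w \<in> ?W \<and> v \<noteq> w" if "f v = Some w" "(v, r) \<in> (parent_rel f)\<^sup>*" for v w
    using parent_rel_step[OF that(1) assms(3) that(2)] parent_mapsD[OF f that(1)] rank[OF that(1)] that(2)
    by (auto simp: component_def)
  have simple: "simple_graph ?W ?E"
    unfolding simple_graph_def
  proof (intro conjI ballI)
    show "finite ?W" using assms by (simp add: component_def)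
    fix e assume "e \<in> ?E"
    then obtain v w where "e = {v, w}" "f v = Some w" "(v, r) \<in> (parent_rel f)\<^sup>*"
      by (auto simp: component_def)
    thus "\<exists>u\<in>?W. \<exists>v\<in>?W. u \<noteq> v \<and> e = {u, v}" using edge by blast
  qed
  have r: "r \<in> ?W" using assms by (simp add: component_def)
  have to_root: "\<exists>p. path_between ?W ?E v p r" if "v \<in> ?W" for v
  proof -
    have vr: "(v, r) \<in> (parent_rel f)\<^sup>*" and "v \<in> V" using that by (auto simp: component_def)
    from chain_exists[OF vr] obtain p where p: "p \<noteq> []" "hd p = v" "last p = r" "distinct p" "is_chain f p"
      and reach: "\<And>x. x \<in> set p \<Longrightarrow> (v, x) \<in> (parent_rel f)\<^sup>*" "\<And>x. x \<in> set p \<Longrightarrow> (x, r) \<in> (parent_rel f)\<^sup>*"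
      by blast
    have "x \<in> V" if "x \<in> set p" for x
      using parent_rel_closed[OF reach(1)[OF that] \<open>v \<in> V\<close>] parent_mapsD(2)[OF f] by blast
    hence "set p \<subseteq> ?W" using reach(2) by (auto simp: component_def)
    moreover have "walk ?E p"
      unfolding walk_eq_successively
      using p(5)[unfolded is_chain_def]
    proof (rule successively_mono)
      fix a b assume "a \<in> set p" "b \<in> set p" "f a = Some b"
      thus "{a, b} \<in> ?E" using reach(2)[of a] by (auto simp: component_def)
    qed
    ultimately show ?thesis using p by (auto simp: path_between_def)
  qed
  have conn: "\<exists>p. path_between ?W ?E u p v" if uv: "u \<in> ?W" "v \<in> ?W" for u v
  proof -
    obtain p q where p: "path_between ?W ?E u p r" and q: "path_between ?W ?E v q r"
      using to_root uv by blast
    obtain p1 q1 w where "path_between ?W ?E u (p1 @ w # rev q1) v" using join_paths[OF p q] .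
    thus ?thesis by blast
  qed
  have "\<nexists>p. cycle ?W ?E p" by (simp add: component_no_cycle)
  moreover have "?W \<noteq> {}" using r by (metis empty_iff)
  ultimately have "tree ?W ?E" unfolding tree_def using simple conn by (intro conjI ballI)
  moreover have "root_of (component V f r) = r" by (simp add: component_def)
  ultimately show ?thesis using r by (simp only: rooted_tree_def)
qed

text \<open>By induction from the root end. A downward step from \<open>a\<close> to
  \<open>b\<close> would need \<open>a\<close> to be the parent of \<open>b\<close>; but
  \<open>b\<close> is either the root, which has no parent, or its parent is the next vertex of the
  path, which is not \<open>a\<close> by distinctness.\<close>

lemma path_to_root_is_chain:
  assumes "path_between (verts (component V f r)) (edges (component V f r)) v p r" "f r = None"
  shows "is_chain f p"
proof -
  have "is_chain f p" if "p \<noteq> []" "distinct p" "last p = r" "walk (edges (component V f r)) p"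
    using that
  proof (induction p)
    case (Cons a p)
    show ?case
    proof (cases p)
      case Nil
      thus ?thesis by (simp add: is_chain_def)
    next
      case (Cons b q)
      have chain: "is_chain f p"
        using Cons Cons.prems Cons.IH by (simp add: walk_eq_successively)
      have "{a, b} \<in> edges (component V f r)"
        using Cons Cons.prems by (simp add: walk_eq_successively)
      hence "f a = Some b \<or> f b = Some a" by (auto simp: component_def doubleton_eq_iff)
      moreover have "f b \<noteq> Some a"
        using chain Cons Cons.prems assms(2) by (cases q) (auto simp: is_chain_def)
      ultimately show ?thesis using chain Cons by (simp add: is_chain_def)
    qed
  qed simp
  thus ?thesis using assms by (simp add: path_between_def)
qed

text \<open>This translates the maximum over a path, as in \<open>is_record\<close>, into the
  maximum over ancestors, as in \<open>map_records\<close>.\<close>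

lemma set_chain_to_root:
  assumes "p \<noteq> []" "is_chain f p" "f (last p) = None"
  shows "set p = {w. (hd p, w) \<in> (parent_rel f)\<^sup>*}"
  using assms
proof (induction p)
  case (Cons a p)
  show ?case
  proof (cases p)
    case Nil
    thus ?thesis using Cons.prems root_reaches_itself_only by auto
  next
    case (Cons b q)
    hence ab: "f a = Some b" and IH: "set p = {w. (b, w) \<in> (parent_rel f)\<^sup>*}"
      using Cons.prems Cons.IH by (auto simp: is_chain_def)
    have "(a, w) \<in> (parent_rel f)\<^sup>* \<longleftrightarrow> w = a \<or> (b, w) \<in> (parent_rel f)\<^sup>*" for w
    proof
      assume "(a, w) \<in> (parent_rel f)\<^sup>*"
      thus "w = a \<or> (b, w) \<in> (parent_rel f)\<^sup>*"
        using ab by (cases rule: converse_rtranclE) (auto simp: parent_rel_def)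
    next
      have "(a, b) \<in> parent_rel f" using ab by (simp add: parent_rel_def)
      thus "w = a \<or> (b, w) \<in> (parent_rel f)\<^sup>* \<Longrightarrow> (a, w) \<in> (parent_rel f)\<^sup>*"
        by (metis converse_rtrancl_into_rtrancl rtrancl.rtrancl_refl)
    qed
    thus ?thesis using IH by auto
  qed
qed simp

end

section \<open>The correspondence between parent maps and rooted forests\<close>

lemma forest_of_rooted_forest:
  assumes f: "f \<in> parent_maps {1..n}"
  shows "rooted_forest n (forest_of {1..n} f)"
proof -
  have "verts (component {1..n} f r) \<inter> verts (component {1..n} f r') = {}"
    if "f r = None" "f r' = None" "component {1..n} f r \<noteq> component {1..n} f r'" for r r'
    using root_unique[OF f, of _ r r'] that by (fastforce simp: component_def)
  hence "disjoint_family_on verts (forest_of {1..n} f)"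
    by (auto simp: disjoint_family_on_def forest_of_def)
  moreover have "(\<Union>T\<in>forest_of {1..n} f. verts T) = {1..n}"
  proof
    show "{1..n} \<subseteq> (\<Union>T\<in>forest_of {1..n} f. verts T)"
    proof
      fix v assume v: "v \<in> {1..n}"
      obtain r where "r \<in> {1..n}" "f r = None" "(v, r) \<in> (parent_rel f)\<^sup>*" using root_exists[OF f v] .
      thus "v \<in> (\<Union>T\<in>forest_of {1..n} f. verts T)"
        using v by (intro UN_I[of "component {1..n} f r"]) (auto simp: forest_of_def component_def)
    qed
  qed (auto simp: forest_of_def component_def)
  moreover have "rooted_tree T" if "T \<in> forest_of {1..n} f" for T
    using that component_rooted_tree[OF f] by (auto simp: forest_of_def)
  ultimately show ?thesis by (simp add: rooted_forest_def)
qed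

lemma path_to_root_exists:
  assumes "f \<in> parent_maps V" "finite V" "r \<in> V" "f r = None" "v \<in> V" "(v, r) \<in> (parent_rel f)\<^sup>*"
  obtains p where "path_between (verts (component V f r)) (edges (component V f r)) v p r"
proof -
  have "tree (verts (component V f r)) (edges (component V f r))"
    using component_rooted_tree[OF assms(1-4)] by (simp add: rooted_tree_def)
  moreover have "v \<in> verts (component V f r)" "r \<in> verts (component V f r)"
    using assms by (auto simp: component_def)
  ultimately show thesis using that unfolding tree_def by blast
qed

text \<open>Every path from \<open>v\<close> to its root is a chain of parents, so its vertex set is
  determined by \<open>v\<close>. The choice of path in \<open>is_record\<close> therefore has no
  influence.\<close>

lemma is_record_forest_of:
  assumes f: "f \<in> parent_maps V" and V: "finite V"
  shows "{v. is_record (forest_of V f) v} = map_records V f"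
proof -
  have set_path: "set p = {w. (v, w) \<in> (parent_rel f)\<^sup>*}"
    if "path_between (verts (component V f r)) (edges (component V f r)) v p r" "f r = None" for v p r
    using set_chain_to_root[OF f _ path_to_root_is_chain[OF f that]] that by (simp add: path_between_def)
  have "is_record (forest_of V f) v \<longleftrightarrow> v \<in> map_records V f" for v
  proof
    assume "is_record (forest_of V f) v"
    then obtain r p where r: "r \<in> V" "f r = None" "\<forall>w\<in>set p. w \<le> v"
      and p: "path_between (verts (component V f r)) (edges (component V f r)) v p r"
      by (auto simp: is_record_def forest_of_def component_def)
    have "v \<in> set p" "set p \<subseteq> verts (component V f r)"
      using p by (auto simp: path_between_def intro: hd_in_set)
    hence "v \<in> V" by (auto simp: component_def)
    thus "v \<in> map_records V f" using r set_path[OF p] by (auto simp: map_records_def)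
  next
    assume v: "v \<in> map_records V f"
    hence "v \<in> V" by (simp add: map_records_def)
    obtain r where r: "r \<in> V" "f r = None" "(v, r) \<in> (parent_rel f)\<^sup>*"
      using root_exists[OF f \<open>v \<in> V\<close>] .
    obtain p where p: "path_between (verts (component V f r)) (edges (component V f r)) v p r"
      using path_to_root_exists[OF f V r(1,2) \<open>v \<in> V\<close> r(3)] .
    have "component V f r \<in> forest_of V f" using r by (simp add: forest_of_def)
    moreover have "root_of (component V f r) = r" by (simp add: component_def)
    moreover have "\<forall>w\<in>set p. w \<le> v" using v set_path[OF p r(2)] by (simp add: map_records_def)
    ultimately show "is_record (forest_of V f) v"
      unfolding is_record_def using p by metis
  qed
  thus ?thesis by blast
qed

text \<open>A component stores its root, so the tree containing \<open>v\<close> has the same root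
  for both maps. A path from \<open>v\<close> to that root is a chain for both, and its second
  vertex is the parent of \<open>v\<close> under either; if there is none, \<open>v\<close> is a
  root for both.\<close>

lemma inj_on_forest_of:
  assumes V: "finite V"
  shows "inj_on (forest_of V) (parent_maps V)"
proof (rule inj_onI, rule ext)
  fix f g v assume f: "f \<in> parent_maps V" and g: "g \<in> parent_maps V" and eq: "forest_of V f = forest_of V g"
  show "f v = g v"
  proof (cases "v \<in> V")
    case False
    thus ?thesis
      using parent_mapsD(1)[OF f, of v] parent_mapsD(1)[OF g, of v] by (cases "f v"; cases "g v") auto
  next
    case True
    obtain r where r: "r \<in> V" "f r = None" "(v, r) \<in> (parent_rel f)\<^sup>*" using root_exists[OF f True] .
    obtain p where p: "path_between (verts (component V f r)) (edges (component V f r)) v p r"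
      using path_to_root_exists[OF f V r(1,2) True r(3)] .
    have "component V f r \<in> forest_of V f" using r by (simp add: forest_of_def)
    hence "component V f r \<in> forest_of V g" by (simp only: eq)
    then obtain r' where r': "g r' = None" "component V f r = component V g r'"
      by (auto simp: forest_of_def)
    moreover have "r' = r" using r'(2) by (simp add: component_def)
    ultimately have gr: "g r = None" and comp: "component V f r = component V g r" by auto
    have chains: "is_chain f p" "is_chain g p"
      using path_to_root_is_chain[OF f p r(2)] path_to_root_is_chain[OF g p[unfolded comp] gr] .
    obtain q where q: "p = v # q" using p by (cases p) (auto simp: path_between_def)
    show ?thesis
    proof (cases q)
      case Nil
      thus ?thesis using q p r(2) gr by (simp add: path_between_def)
    next
      case (Cons w s)
      thus ?thesis using q chains by (simp add: is_chain_def)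
    qed
  qed
qed

text \<open>The parent of \<open>v\<close> is the second vertex of a chosen path from
  \<open>v\<close> to the root of its tree. Connectedness provides the path, and
  \<open>tree_edge_on_path\<close> shows that these parent links exhaust the edges.\<close>

lemma rooted_forest_is_forest_of:
  assumes F: "rooted_forest n F"
  shows "F \<in> forest_of {1..n} ` parent_maps {1..n}"
proof -
  define V where "V = {1..n}"
  have tree: "tree (verts T) (edges T)" and root: "root_of T \<in> verts T" and sub: "verts T \<subseteq> V"
    if "T \<in> F" for T
    using F that unfolding rooted_forest_def rooted_tree_def V_def by blast+
  have disj: "T = T'" if "T \<in> F" "T' \<in> F" "v \<in> verts T" "v \<in> verts T'" for T T' v
    using F that unfolding rooted_forest_def disjoint_family_on_def by blast
  have cover: "\<exists>T\<in>F. v \<in> verts T" if "v \<in> V" for v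
    using F that unfolding rooted_forest_def V_def by blast
  define path where "path v p \<longleftrightarrow> (\<exists>T\<in>F. path_between (verts T) (edges T) v p (root_of T))" for v p
  \<comment> \<open>Choosing shortest paths to the root makes their length decrease from a vertex to its parent.\<close>
  define sp where "sp v = arg_min length (path v)" for v
  define f where "f v = (if v \<in> V then case sp v of _ # w # _ \<Rightarrow> Some w | _ \<Rightarrow> None else None)" for v
  have path_T: "path_between (verts T) (edges T) v p (root_of T)"
    if vp: "path v p" and T: "T \<in> F" "v \<in> verts T" for T v p
  proof -
    obtain T' where T': "T' \<in> F" "path_between (verts T') (edges T') v p (root_of T')"
      using vp unfolding path_def by blast
    hence "v \<in> verts T'" using hd_in_set[of p] by (auto simp: path_between_def)
    thus ?thesis using disj[OF T(1) T'(1) T(2)] T' by simp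
  qed
  have path_sp: "path v (sp v)" if v: "v \<in> V" for v
  proof -
    obtain T where T: "T \<in> F" "v \<in> verts T" using cover[OF v] by blast
    obtain p where "path_between (verts T) (edges T) v p (root_of T)"
      using tree[OF T(1)] root[OF T(1)] T(2) unfolding tree_def by blast
    hence "path v p" using T(1) unfolding path_def by blast
    thus ?thesis unfolding sp_def by (rule arg_min_natI)
  qed
  have sp_le: "length (sp v) \<le> length p" if "path v p" for v p
    unfolding sp_def using that by (rule arg_min_nat_le)
  have f_Some: "{v, w} \<in> edges T \<and> v \<in> verts T \<and> w \<in> verts T \<and> length (sp w) < length (sp v)"
    if vw: "f v = Some w" and T: "T \<in> F" "v \<in> verts T" for v w T
  proof -
    have v: "v \<in> V" using sub T by blast
    have p: "path_between (verts T) (edges T) v (sp v) (root_of T)"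
      using path_T[OF path_sp[OF v] T] .
    obtain a q where "sp v = a # w # q" using vw by (auto simp: f_def split: if_splits list.splits)
    moreover from this have "a = v" using p by (simp add: path_between_def)
    ultimately have q: "sp v = v # w # q" by simp
    have w: "w \<in> verts T" and e: "{v, w} \<in> edges T"
      and "path_between (verts T) (edges T) w (w # q) (root_of T)"
      using p q by (auto simp: path_between_def walk_eq_successively)
    hence "length (sp w) \<le> length (w # q)"
      using sp_le[of w "w # q"] T(1) unfolding path_def by blast
    thus ?thesis using q w e T by simp
  qed
  have f_None: "f v = None \<longleftrightarrow> v = root_of T" if T: "T \<in> F" "v \<in> verts T" for v T
  proof -
    have v: "v \<in> V" using sub that by blast
    have p: "path_between (verts T) (edges T) v (sp v) (root_of T)"
      using path_T[OF path_sp[OF v] that] .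
    show ?thesis
    proof
      assume "f v = None"
      hence "sp v = [v]" using v p by (auto simp: f_def path_between_def split: list.splits)
      thus "v = root_of T" using p by (simp add: path_between_def)
    next
      assume "v = root_of T"
      hence "path_between (verts T) (edges T) v [v] (root_of T)"
        using T by (simp add: path_between_def walk_def)
      hence "path v [v]" using T(1) unfolding path_def by blast
      hence "length (sp v) \<le> 1" using sp_le[of v "[v]"] by simp
      thus "f v = None" by (auto simp: f_def split: list.splits)
    qed
  qed
  have f: "f \<in> parent_maps V"
  proof (rule parent_mapsI)
    fix v w assume vw: "f v = Some w"
    hence v: "v \<in> V" by (simp add: f_def split: if_splits)
    then obtain T where T: "T \<in> F" "v \<in> verts T" using cover by blast
    show "v \<in> V \<and> w \<in> V \<and> length (sp w) < length (sp v)"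
      using f_Some[OF vw T] sub[OF T(1)] v by blast
  qed
  have in_T: "v \<in> verts T \<longleftrightarrow> v \<in> V \<and> (v, root_of T) \<in> (parent_rel f)\<^sup>*" if T: "T \<in> F" for v T
  proof
    assume v: "v \<in> verts T"
    hence "v \<in> V" using sub[OF T] by blast
    obtain r where r: "r \<in> V" "f r = None" "(v, r) \<in> (parent_rel f)\<^sup>*" using root_exists[OF f \<open>v \<in> V\<close>] .
    have "r \<in> verts T" using parent_rel_closed[of v r f "verts T"] r(3) v f_Some[OF _ T] by blast
    hence "r = root_of T" using f_None[OF T] r(2) by blast
    thus "v \<in> V \<and> (v, root_of T) \<in> (parent_rel f)\<^sup>*" using \<open>v \<in> V\<close> r by blast
  next
    assume v: "v \<in> V \<and> (v, root_of T) \<in> (parent_rel f)\<^sup>*"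
    then obtain T' where T': "T' \<in> F" "v \<in> verts T'" using cover by blast
    \<comment> \<open>Following parents never leaves a tree, so the root reached from
      \<open>v\<close> lies in the tree of \<open>v\<close>; disjointness then identifies the two
      trees.\<close>
    have "root_of T \<in> verts T'"
      using parent_rel_closed[of v "root_of T" f "verts T'"] v T'(2) f_Some[OF _ T'(1)] by blast
    thus "v \<in> verts T" using disj[OF T T'(1) root[OF T]] T'(2) by blast
  qed
  have component: "component V f (root_of T) = T" if T: "T \<in> F" for T
  proof -
    have "edges T = {{v, w} | v w. f v = Some w \<and> (v, root_of T) \<in> (parent_rel f)\<^sup>*}" (is "_ = ?E")
    proof (intro equalityI subsetI)
      fix e assume e: "e \<in> edges T"
      then obtain u v where uv: "u \<in> verts T" "v \<in> verts T" "e = {u, v}"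
        using tree[OF T] unfolding tree_def simple_graph_def by blast
      hence V: "u \<in> V" "v \<in> V" using sub[OF T] by auto
      \<comment> \<open>Acyclicity enters here: one of the two chosen paths begins with this edge,
        so the edge joins a vertex to its parent.\<close>
      have "(\<exists>s. sp u = u # v # s) \<or> (\<exists>s. sp v = v # u # s)"
        using tree_edge_on_path[OF tree[OF T] path_T[OF path_sp[OF V(1)] T uv(1)]
            path_T[OF path_sp[OF V(2)] T uv(2)]] e uv(3) by simp
      hence "f u = Some v \<or> f v = Some u" using V by (auto simp: f_def)
      moreover have "(u, root_of T) \<in> (parent_rel f)\<^sup>*" "(v, root_of T) \<in> (parent_rel f)\<^sup>*"
        using uv in_T[OF T] by auto
      moreover have "e = {v, u}" using uv(3) by (simp add: insert_commute)
      ultimately show "e \<in> ?E" using uv(3) by blast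
    next
      fix e assume "e \<in> ?E"
      then obtain v w where vw: "e = {v, w}" "f v = Some w" "(v, root_of T) \<in> (parent_rel f)\<^sup>*" by blast
      hence "v \<in> verts T" using in_T[OF T] parent_mapsD(1)[OF f vw(2)] by blast
      thus "e \<in> edges T" using f_Some[OF vw(2) T] vw(1) by blast
    qed
    moreover have "verts T = {v \<in> V. (v, root_of T) \<in> (parent_rel f)\<^sup>*}" using in_T[OF T] by blast
    ultimately show ?thesis by (cases T) (simp add: component_def)
  qed
  have "{r \<in> V. f r = None} = root_of ` F"
  proof (intro equalityI subsetI)
    fix r assume r: "r \<in> {r \<in> V. f r = None}"
    then obtain T where T: "T \<in> F" "r \<in> verts T" using cover by blast
    hence "r = root_of T" using f_None[OF T] r by simp
    thus "r \<in> root_of ` F" using T(1) by (rule image_eqI)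
  next
    fix r assume "r \<in> root_of ` F"
    then obtain T where T: "T \<in> F" and r: "r = root_of T" by blast
    show "r \<in> {r \<in> V. f r = None}" unfolding r using f_None[OF T root[OF T]] root[OF T] sub[OF T] by blast
  qed
  hence "forest_of V f = component V f ` root_of ` F" by (simp only: forest_of_def)
  also have "\<dots> = (\<lambda>T. T) ` F" unfolding image_image by (intro image_cong refl component)
  finally have "F = forest_of {1..n} f" by (simp add: V_def)
  thus ?thesis using f unfolding V_def by (rule image_eqI)
qed

lemma num_record_forests_eq_card:
  "num_record_forests n k = card {f \<in> parent_maps {1..n}. card (map_records {1..n} f) = k}"
    (is "_ = card ?P")
proof -
  have records: "card {v. is_record (forest_of {1..n} f) v} = card (map_records {1..n} f)"
    if "f \<in> parent_maps {1..n}" for f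
    by (subst is_record_forest_of[OF that]) simp_all
  have "{F. rooted_forest n F \<and> card {v. is_record F v} = k} = forest_of {1..n} ` ?P"
  proof (intro equalityI subsetI)
    fix F assume "F \<in> forest_of {1..n} ` ?P"
    then obtain f where f: "f \<in> ?P" and F: "F = forest_of {1..n} f" by (rule imageE)
    show "F \<in> {F. rooted_forest n F \<and> card {v. is_record F v} = k}"
      unfolding F using forest_of_rooted_forest[of f n] records[of f] f by simp
  next
    fix F assume "F \<in> {F. rooted_forest n F \<and> card {v. is_record F v} = k}"
    hence F: "rooted_forest n F" "card {v. is_record F v} = k" by simp_all
    obtain f where f: "F = forest_of {1..n} f" "f \<in> parent_maps {1..n}"
      using rooted_forest_is_forest_of[OF F(1)] by (rule imageE)
    have "f \<in> ?P" using F(2) records[OF f(2)] f by simp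
    with f(1) show "F \<in> forest_of {1..n} ` ?P" by (rule image_eqI)
  qed
  moreover have "card (forest_of {1..n} ` ?P) = card ?P"
    by (rule card_image[OF inj_on_subset[OF inj_on_forest_of]]) auto
  ultimately show ?thesis by (simp only: num_record_forests_def)
qed

section \<open>The record distribution\<close>

lemma coeff_record_gf:
  assumes "finite V"
  shows "coeff (record_gf V) k = real (card {f \<in> parent_maps V. card (map_records V f) = k})"
proof -
  have "coeff (record_gf V) k = (\<Sum>f\<in>parent_maps V. if card (map_records V f) = k then 1 else 0)"
    by (simp add: record_gf_def coeff_sum coeff_monom)
  also have "\<dots> = (\<Sum>f\<in>{f \<in> parent_maps V. card (map_records V f) = k}. 1)"
    by (rule sum.inter_filter[OF finite_parent_maps[OF assms], symmetric])
  finally show ?thesis by simp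
qed

text \<open>The substitution is \<open>m = i + 1\<close>. Terms with
  \<open>1 \<le> m \<le> k\<close> drop out because the truncated index \<open>m - k\<close> is
  \<open>0\<close> and \<open>stirling m 0 = 0\<close>.\<close>

lemma coeff_record_poly:
  "coeff (record_poly n) k = (\<Sum>m = k+1..n+1. (-1) ^ (m + k - 1) * real (n choose (m - 1)) * real m *
        (real n + 1) powi (int n - int m) * real (stirling m (m - k)))"
proof -
  let ?t = "\<lambda>m. (-1) ^ (m + k - 1) * real (n choose (m - 1)) * real m *
        (real n + 1) powi (int n - int m) * real (stirling m (m - k))"
  have "coeff (record_poly n) k = (\<Sum>i\<le>n. ?t (Suc i))"
    unfolding record_poly_def coeff_sum coeff_smult coeff_rising_prod
    by (intro sum.cong refl) (simp add: algebra_simps)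
  also have "\<dots> = sum ?t {1..n+1}"
    by (rule sum.reindex_bij_witness[of _ "\<lambda>m. m - 1" Suc]) auto
  also have "\<dots> = sum ?t {k+1..n+1}"
    by (rule sum.mono_neutral_right) auto
  finally show ?thesis .
qed

theorem mainTheorem2:
  fixes n k :: nat
  assumes "n \<ge> 1" and "1 \<le> k" and "k \<le> n"
  shows "real (num_record_forests n k) =
    (\<Sum>m = k+1..n+1. (-1) ^ (m + k - 1) * real (n choose (m - 1)) * real m *
        (real n + 1) powi (int n - int m) * real (num_cycle_perms m (m - k)))"
  unfolding num_record_forests_eq_card num_cycle_perms_eq_stirling coeff_record_poly[symmetric]
  using coeff_record_gf[of "{1..n}" k] record_gf_eq[of "{1..n}"] by simp

end
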